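(* Let \[B(t,x,y)=\sum_{n\ge 0}\ \sum_{\pi\in \mathfrak{S}_n^{[3]}(231)} t^{c_1(\pi)}x^{c_2(\pi)}y^{c_3(\pi)}.\] Then \[ B(t,x,y) = \dfrac{(1-x)^2(1-2y)}{1 - 3 x - 3 y - t + 2 x^2 + 5 x y + t x - 5 x^2 y - 4 t x y - t^2y}. \]
   Context: $\mathfrak{S}_n$ is the symmetric group on $[n]=\{1,\dots,n\}$; permutations are written in one-line notation $\pi=\pi_1\cdots\pi_n$ with $\pi_i=\pi(i)$. A permutation $\pi$ contains a pattern $\sigma\in\mathfrak{S}_k$ if some subsequence of $\pi_1\cdots\pi_n$ of length $k$ is in the same relative order as $\sigma$; otherwise $\pi$ avoids $\sigma$. $\mathfrak{S}_n^{[3]}(231)$ is the set of permutations in $\mathfrak{S}_n$ that avoid $231$ and all of whose cycles (in the disjoint cycle decomposition) have length $1$, $2$ or $3$; $\mathfrak{S}_0^{[3]}(231)$ consists of the empty permutation. $c_k(\pi)$ denotes the number of $k$-cycles of $\pi$. *)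

theory Defs
  imports "HOL-Computational_Algebra.Formal_Power_Series" "HOL-Combinatorics.Combinatorics"
begin

definition avoids231 :: "nat \<Rightarrow> (nat \<Rightarrow> nat) \<Rightarrow> bool" where
  "avoids231 n \<pi> \<longleftrightarrow>
     \<not> (\<exists>i j k. 1 \<le> i \<and> i < j \<and> j < k \<and> k \<le> n \<and> \<pi> k < \<pi> i \<and> \<pi> i < \<pi> j)"

definition S3_231 :: "nat \<Rightarrow> (nat \<Rightarrow> nat) set" where
  "S3_231 n = {\<pi>. \<pi> permutes {1..n} \<and> avoids231 n \<pi> \<and>
                  (\<forall>i\<in>{1..n}. card (orbit \<pi> i) \<in> {1,2,3})}"

definition ncycles :: "nat \<Rightarrow> nat \<Rightarrow> (nat \<Rightarrow> nat) \<Rightarrow> nat" where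
  "ncycles k n \<pi> = card {i \<in> {1..n}. card (orbit \<pi> i) = k} div k"

text \<open>Coefficient of t^a x^b y^c in B(t,x,y): since c1 + 2 c2 + 3 c3 = n, only
  n = a + 2b + 3c contributes.\<close>

definition Bcoeff :: "nat \<Rightarrow> nat \<Rightarrow> nat \<Rightarrow> nat" where
  "Bcoeff a b c = card {\<pi> \<in> S3_231 (a + 2*b + 3*c).
       ncycles 1 (a + 2*b + 3*c) \<pi> = a \<and> ncycles 2 (a + 2*b + 3*c) \<pi> = b \<and>
       ncycles 3 (a + 2*b + 3*c) \<pi> = c}"

text \<open>Trivariate formal power series over int as nested fps:
  outer variable y, middle x, inner t.\<close>

type_synonym fps3 = "int fps fps fps"

definition varT :: fps3 where "varT = fps_const (fps_const fps_X)"
definition varX :: fps3 where "varX = fps_const fps_X"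
definition varY :: fps3 where "varY = fps_X"

definition Bseries :: fps3 where
  "Bseries = Abs_fps (\<lambda>c. Abs_fps (\<lambda>b. Abs_fps (\<lambda>a. int (Bcoeff a b c))))"

end

theory Submission
  imports Defs "HOL-Library.Product_Plus"
begin

text \<open>
  Splitting a 231-avoiding permutation just before its maximum writes it as a direct sum, so
  \<open>B = 1 + B I\<close>, where \<open>I\<close> counts the permutations with \<open>\<pi> 1 = n\<close>. Such a permutation is either
  decreasing or contains a 3-cycle \<open>1 \<mapsto> n \<mapsto> k \<mapsto> 1\<close>. Let \<open>E\<close> count all decreasing permutations
  (including the empty one) and \<open>D\<close> those of the second kind, so \<open>I = E - 1 + D\<close>.

  Deleting \<open>1, k, n\<close> leaves a permutation \<open>\<sigma>\<close> of the same class, together with a height \<open>p = k - 2\<close>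
  such that the first \<open>p\<close> entries of \<open>\<sigma>\<close> decrease and the entries exceeding \<open>p\<close> decrease;
  conversely any such pair can be extended. A decreasing \<open>\<sigma>\<close> of size \<open>r\<close> admits all \<open>r + 1\<close> heights,
  one counted by \<open>D\<close> admits two, a direct sum of two nonempty decreasing permutations admits one,
  and no other permutation admits any. Hence \<open>D = y (M + 2 D + (E - 1)\<^sup>2)\<close>, where \<open>M\<close> counts each
  decreasing permutation of size \<open>r\<close> with multiplicity \<open>r + 1\<close>; here \<open>(1 - x) E = 1 + t\<close> and
  \<open>(1 - x) M = 2 E - 1\<close>.
\<close>

unbundle fps_syntax

declare One_nat_def [simp del] add_2_eq_Suc' [simp del]

section \<open>Weighted generating functions\<close>

definition finite_fibres :: "('a \<Rightarrow> 'b) \<Rightarrow> 'a set \<Rightarrow> bool" where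
  "finite_fibres W S \<longleftrightarrow> (\<forall>v. finite {s \<in> S. W s = v})"

definition genfun :: "('a \<Rightarrow> nat \<times> nat \<times> nat) \<Rightarrow> 'a set \<Rightarrow> fps3" where
  "genfun W S = Abs_fps (\<lambda>c. Abs_fps (\<lambda>b. Abs_fps (\<lambda>a. int (card {s \<in> S. W s = (a, b, c)}))))"

definition monomial :: "nat \<times> nat \<times> nat \<Rightarrow> fps3" where
  "monomial = (\<lambda>(a, b, c). varT ^ a * varX ^ b * varY ^ c)"

lemma genfun_nth: "genfun W S $ c $ b $ a = int (card {s \<in> S. W s = (a, b, c)})"
  by (simp add: genfun_def)

lemma monomial_nth: "monomial v $ c $ b $ a = (if v = (a, b, c) then 1 else 0)"
proof -
  obtain i j k where v: "v = (i, j, k)" by (cases v)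
  have "monomial v = fps_const (fps_const (fps_X ^ i) * fps_X ^ j) * fps_X ^ k"
    by (simp add: v monomial_def varT_def varX_def varY_def)
  then show ?thesis by (simp add: v)
qed

lemma fps3_eqI:
  fixes F G :: "'a::zero fps fps fps"
  assumes "\<And>a b c. F $ c $ b $ a = G $ c $ b $ a"
  shows "F = G"
  using assms by (simp add: fps_eq_iff)

lemma finite_fibresD: "finite_fibres W S \<Longrightarrow> finite {s \<in> S. W s = v}"
  by (simp add: finite_fibres_def)

lemma finite_fibres_subset: "finite_fibres W S \<Longrightarrow> R \<subseteq> S \<Longrightarrow> finite_fibres W R"
  unfolding finite_fibres_def by (fast elim: rev_finite_subset)

lemma finite_fibres_Sigma:
  assumes "finite_fibres W S" "\<And>s. s \<in> S \<Longrightarrow> finite (P s)"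
  shows "finite_fibres (\<lambda>u. W (fst u)) (Sigma S P)"
  unfolding finite_fibres_def
proof
  fix v
  have "{u \<in> Sigma S P. W (fst u) = v} = Sigma {s \<in> S. W s = v} P" by auto
  moreover have "finite (Sigma {s \<in> S. W s = v} P)"
    by (rule finite_SigmaI) (use assms in \<open>auto simp: finite_fibresD\<close>)
  ultimately show "finite {u \<in> Sigma S P. W (fst u) = v}" by simp
qed

lemma genfun_bij_betw:
  assumes "bij_betw f S R" "\<And>s. s \<in> S \<Longrightarrow> V (f s) = W s"
  shows "genfun V R = genfun W S"
proof (rule fps3_eqI)
  fix a b c
  have "bij_betw f {s \<in> S. W s = (a, b, c)} {r \<in> R. V r = (a, b, c)}"
    using assms unfolding bij_betw_def by (auto simp: inj_on_def)
  then show "genfun V R $ c $ b $ a = genfun W S $ c $ b $ a"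
    by (simp add: genfun_nth bij_betw_same_card)
qed

lemma genfun_image: "inj_on f S \<Longrightarrow> genfun W (f ` S) = genfun (\<lambda>s. W (f s)) S"
  by (rule genfun_bij_betw) (simp_all add: bij_betw_imageI)

lemma genfun_Un:
  assumes "finite_fibres W (S \<union> R)" "S \<inter> R = {}"
  shows "genfun W (S \<union> R) = genfun W S + genfun W R"
proof (rule fps3_eqI)
  fix a b c
  have "{s \<in> S \<union> R. W s = (a, b, c)} = {s \<in> S. W s = (a, b, c)} \<union> {s \<in> R. W s = (a, b, c)}"
    by auto
  moreover have "finite_fibres W S" "finite_fibres W R"
    using finite_fibres_subset[OF assms(1)] by auto
  moreover have "{s \<in> S. W s = (a, b, c)} \<inter> {s \<in> R. W s = (a, b, c)} = {}"
    using assms(2) by auto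
  ultimately show "genfun W (S \<union> R) $ c $ b $ a = (genfun W S + genfun W R) $ c $ b $ a"
    by (simp add: genfun_nth card_Un_disjoint finite_fibresD)
qed

lemma genfun_Un3:
  assumes "finite_fibres W (S \<union> (R \<union> Q))" "S \<inter> (R \<union> Q) = {}" "R \<inter> Q = {}"
  shows "genfun W (S \<union> (R \<union> Q)) = genfun W S + (genfun W R + genfun W Q)"
  using genfun_Un[OF assms(1,2)] genfun_Un[OF finite_fibres_subset[OF assms(1)] assms(3)] by simp

lemma fibre_Times:
  fixes a b c :: nat
  shows "{u \<in> S \<times> R. W (fst u) + V (snd u) = (a, b, c)} =
    (\<Union>(k, j, i) \<in> {0..c} \<times> {0..b} \<times> {0..a}.
        {s \<in> S. W s = (i, j, k)} \<times> {r \<in> R. V r = (a - i, b - j, c - k)})" (is "?L = ?R")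
proof
  show "?L \<subseteq> ?R"
  proof
    fix u assume "u \<in> ?L"
    then obtain s r where u: "u = (s, r)" "s \<in> S" "r \<in> R" "W s + V r = (a, b, c)" by auto
    obtain i j k where w: "W s = (i, j, k)" by (cases "W s")
    obtain i' j' k' where v: "V r = (i', j', k')" by (cases "V r")
    from u w v have "i + i' = a" "j + j' = b" "k + k' = c" by auto
    then show "u \<in> ?R" using u w v by (intro UN_I[of "(k, j, i)"]) auto
  qed
qed auto

lemma genfun_Times:
  assumes "finite_fibres W S" "finite_fibres V R"
  shows "genfun (\<lambda>u. W (fst u) + V (snd u)) (S \<times> R) = genfun W S * genfun V R"
proof (rule fps3_eqI)
  fix a b c :: nat
  let ?I = "{0..c} \<times> {0..b} \<times> {0..a}"
  let ?F = "\<lambda>(k, j, i). {s \<in> S. W s = (i, j, k)} \<times> {r \<in> R. V r = (a - i, b - j, c - k)}"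
  have "card (\<Union>z\<in>?I. ?F z) = (\<Sum>z\<in>?I. card (?F z))"
    by (rule card_UN_disjoint) (auto intro: assms finite_fibresD)
  also have "\<dots> = (\<Sum>k\<in>{0..c}. \<Sum>j\<in>{0..b}. \<Sum>i\<in>{0..a}.
      card {s \<in> S. W s = (i, j, k)} * card {r \<in> R. V r = (a - i, b - j, c - k)})"
    by (simp add: sum.cartesian_product case_prod_beta card_cartesian_product)
  finally show "genfun (\<lambda>u. W (fst u) + V (snd u)) (S \<times> R) $ c $ b $ a =
      (genfun W S * genfun V R) $ c $ b $ a"
    unfolding genfun_nth fibre_Times by (simp add: fps_mult_nth fps_sum_nth genfun_nth)
qed

lemma genfun_Sigma_card:
  assumes "finite_fibres W S" "\<And>s. s \<in> S \<Longrightarrow> finite (P s)" "\<And>s. s \<in> S \<Longrightarrow> card (P s) = m"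
  shows "genfun (\<lambda>u. W (fst u)) (Sigma S P) = of_nat m * genfun W S"
proof (rule fps3_eqI)
  fix a b c
  have "{u \<in> Sigma S P. W (fst u) = (a, b, c)} = Sigma {s \<in> S. W s = (a, b, c)} P" by auto
  then show "genfun (\<lambda>u. W (fst u)) (Sigma S P) $ c $ b $ a = (of_nat m * genfun W S) $ c $ b $ a"
    using assms by (simp add: genfun_nth finite_fibresD)
qed

lemma genfun_singleton: "genfun W {s} = monomial (W s)"
proof (rule fps3_eqI)
  fix a b c
  have "{r \<in> {s}. W r = (a, b, c)} = (if W s = (a, b, c) then {s} else {})" by auto
  then show "genfun W {s} $ c $ b $ a = monomial (W s) $ c $ b $ a"
    by (simp add: genfun_nth monomial_nth)
qed

lemma genfun_shift:
  assumes "finite_fibres W S"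
  shows "genfun (\<lambda>s. W s + v) S = genfun W S * monomial v"
proof -
  have "genfun (\<lambda>s. W s + v) S = genfun (\<lambda>u. W (fst u) + v) (S \<times> {()})"
    by (rule genfun_bij_betw[where f = fst]) (auto simp: bij_betw_def inj_on_def)
  also have "\<dots> = genfun W S * genfun (\<lambda>_. v) {()}"
    by (rule genfun_Times[OF assms]) (simp add: finite_fibres_def)
  finally show ?thesis by (simp add: genfun_singleton)
qed

section \<open>Cycle types\<close>

definition cycle_type :: "'a set \<Rightarrow> ('a \<Rightarrow> 'a) \<Rightarrow> nat multiset" where
  "cycle_type A \<pi> = image_mset card (mset_set (orbit \<pi> ` A))"

lemma
  assumes "\<alpha> permutes A" "\<beta> permutes B" "A \<inter> B = {}"
  shows comp_permutes_left: "x \<in> A \<Longrightarrow> (\<alpha> \<circ> \<beta>) x = \<alpha> x"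
    and comp_permutes_right: "x \<in> B \<Longrightarrow> (\<alpha> \<circ> \<beta>) x = \<beta> x"
    and comp_permutes_Un: "\<alpha> \<circ> \<beta> permutes A \<union> B"
proof -
  show "(\<alpha> \<circ> \<beta>) x = \<alpha> x" if "x \<in> A"
    using permutes_not_in[OF assms(2), of x] assms(3) that by (simp add: disjoint_iff)
  show "(\<alpha> \<circ> \<beta>) x = \<beta> x" if "x \<in> B"
    using permutes_not_in[OF assms(1), of "\<beta> x"] permutes_in_image[OF assms(2), of x] assms(3) that
    by (auto simp: disjoint_iff)
  show "\<alpha> \<circ> \<beta> permutes A \<union> B"
    using assms(1,2) by (auto intro!: permutes_compose intro: permutes_subset)
qed

lemma permutes_Un_eq_onE:
  assumes "\<pi> permutes A \<union> B" "A \<inter> B = {}" "\<beta> permutes B" "\<And>x. x \<in> B \<Longrightarrow> \<pi> x = \<beta> x"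
  obtains \<alpha> where "\<alpha> permutes A" "\<pi> = \<alpha> \<circ> \<beta>"
proof
  have "inv \<beta> permutes A \<union> B"
    using permutes_inv[OF assms(3)] by (rule permutes_subset) simp
  then have "\<pi> \<circ> inv \<beta> permutes A \<union> B" using assms(1) by (rule permutes_compose)
  moreover have "(\<pi> \<circ> inv \<beta>) x = x" if "x \<in> A \<union> B - A" for x
  proof -
    have "inv \<beta> x \<in> B" using that permutes_in_image[OF permutes_inv[OF assms(3)]] by auto
    then show ?thesis using assms(4) permutes_inverses(1)[OF assms(3)] by simp
  qed
  ultimately show "\<pi> \<circ> inv \<beta> permutes A" by (rule permutes_superset)
  show "\<pi> = \<pi> \<circ> inv \<beta> \<circ> \<beta>"
    by (simp add: comp_assoc permutes_inv_o(2)[OF assms(3)])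
qed

lemma permutes_Un_invariantE:
  assumes \<pi>: "\<pi> permutes A \<union> B" and disj: "A \<inter> B = {}" and "finite A" "\<pi> ` A \<subseteq> A"
  obtains \<alpha> \<beta> where "\<alpha> permutes A" "\<beta> permutes B" "\<pi> = \<alpha> \<circ> \<beta>"
proof -
  have inj: "inj_on \<pi> X" for X using permutes_inj_on[OF \<pi>] .
  have "\<pi> ` A = A" using endo_inj_surj[OF assms(3,4) inj] .
  moreover have "\<pi> ` (A \<union> B - A) = \<pi> ` (A \<union> B) - \<pi> ` A"
    using permutes_inj[OF \<pi>] by (rule image_set_diff)
  moreover have "A \<union> B - A = B" using disj by blast
  ultimately have "bij_betw \<pi> B B"
    using permutes_image[OF \<pi>] inj by (simp add: bij_betw_def)
  then have \<beta>: "restrict_id \<pi> B permutes B" by (rule permutes_restrict_id)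
  obtain \<alpha> where "\<alpha> permutes A" "\<pi> = \<alpha> \<circ> restrict_id \<pi> B"
    using permutes_Un_eq_onE[OF \<pi> disj \<beta>] by (metis restrict_id_simps(1))
  with \<beta> show thesis using that by blast
qed

lemma permutes_imageE:
  assumes "\<alpha> permutes f ` A" "inj_on f A"
  obtains \<sigma> where "\<sigma> permutes A" "\<alpha> = map_permutation A f \<sigma>"
proof
  have bij: "bij_betw (inv_into A f) (f ` A) A"
    using assms(2) by (simp add: bij_betw_inv_into bij_betw_imageI)
  show "map_permutation (f ` A) (inv_into A f) \<alpha> permutes A"
    using bij assms(1) by (rule map_permutation_permutes)
  show "\<alpha> = map_permutation A f (map_permutation (f ` A) (inv_into A f) \<alpha>)"
    using map_permutation_compose_inv[OF bij assms(1), of f] by (simp add: f_inv_into_f)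
qed

lemma permutes_self_in_orbit:
  assumes "finite A" "\<pi> permutes A"
  shows "x \<in> orbit \<pi> x"
  using assms by (meson permutation_permutes permutation_self_in_orbit)

lemma orbit_image_cong:
  assumes "\<alpha> permutes A" "\<And>x. x \<in> A \<Longrightarrow> \<pi> x = \<alpha> x"
  shows "orbit \<pi> ` A = orbit \<alpha> ` A"
proof (rule image_cong[OF refl])
  show "orbit \<pi> x = orbit \<alpha> x" if "x \<in> A" for x
    by (rule orbit_cong0[OF that, symmetric])
      (simp_all add: assms(2) permutes_in_image[OF assms(1)])
qed

lemma cycle_type_comp:
  assumes "finite A" "finite B" "\<alpha> permutes A" "\<beta> permutes B" "A \<inter> B = {}"
  shows "cycle_type (A \<union> B) (\<alpha> \<circ> \<beta>) = cycle_type A \<alpha> + cycle_type B \<beta>"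
proof -
  have orbits_A: "orbit (\<alpha> \<circ> \<beta>) ` A = orbit \<alpha> ` A"
    using assms(3) comp_permutes_left[OF assms(3-5)] by (rule orbit_image_cong)
  have orbits_B: "orbit (\<alpha> \<circ> \<beta>) ` B = orbit \<beta> ` B"
    using assms(4) comp_permutes_right[OF assms(3-5)] by (rule orbit_image_cong)
  have "orbit \<alpha> x \<noteq> orbit \<beta> y" if "x \<in> A" "y \<in> B" for x y
    using permutes_orbit_subset[OF assms(3) that(1)] permutes_orbit_subset[OF assms(4) that(2)]
      orbit_nonempty[of \<alpha> x] assms(5) by blast
  then have "orbit \<alpha> ` A \<inter> orbit \<beta> ` B = {}" by auto
  then show ?thesis
    unfolding cycle_type_def image_Un orbits_A orbits_B
    using assms(1,2) by (simp add: mset_set_Union)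
qed

lemma cycle_type_map_permutation:
  assumes "finite A" "\<sigma> permutes A" "inj_on f A"
  shows "cycle_type (f ` A) (map_permutation A f \<sigma>) = cycle_type A \<sigma>"
proof -
  have orbit: "orbit (map_permutation A f \<sigma>) (f x) = f ` orbit \<sigma> x" if "x \<in> A" for x
    using permutes_orbit_subset[OF assms(2) that] permutes_self_in_orbit[OF assms(1,2)] assms(3)
    by (intro orbit_inverse[symmetric]) (auto simp: map_permutation_apply)
  have sub: "orbit \<sigma> ` A \<subseteq> Pow A"
    using permutes_orbit_subset[OF assms(2)] by auto
  then have inj: "inj_on (image f) (orbit \<sigma> ` A)"
    by (rule inj_on_subset[OF inj_on_image_Pow[OF assms(3)]])
  have card_image_f: "card (f ` C) = card C" if "C \<in> orbit \<sigma> ` A" for C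
    using sub that by (intro card_image inj_on_subset[OF assms(3)]) blast
  have "orbit (map_permutation A f \<sigma>) ` f ` A = image f ` orbit \<sigma> ` A"
    unfolding image_image by (rule image_cong[OF refl orbit])
  then have "cycle_type (f ` A) (map_permutation A f \<sigma>) =
      image_mset (\<lambda>C. card (f ` C)) (mset_set (orbit \<sigma> ` A))"
    using image_mset_mset_set[OF inj, symmetric]
    by (simp add: cycle_type_def image_mset.compositionality comp_def)
  also have "\<dots> = cycle_type A \<sigma>"
    unfolding cycle_type_def by (rule image_mset_cong) (use assms(1) card_image_f in auto)
  finally show ?thesis .
qed

lemma set_mset_cycle_type: "finite A \<Longrightarrow> set_mset (cycle_type A \<pi>) = (\<lambda>i. card (orbit \<pi> i)) ` A"
  by (simp add: cycle_type_def image_image)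

lemma card_points_orbit_card:
  assumes "finite A" "\<pi> permutes A"
  shows "card {i \<in> A. card (orbit \<pi> i) = k} = k * count (cycle_type A \<pi>) k"
proof -
  let ?C = "{C \<in> orbit \<pi> ` A. card C = k}"
  note cyclic = cyclic_on_orbit[OF assms(2,1)] and self = permutes_self_in_orbit[OF assms]
  have "\<Union>?C = {i \<in> A. card (orbit \<pi> i) = k}"
    using permutes_orbit_subset[OF assms(2)] orbit_cyclic_eq3[OF cyclic] self by fastforce
  moreover have "k * card ?C = card (\<Union>?C)"
  proof (rule card_partition)
    show "finite (\<Union>?C)"
      using permutes_orbit_subset[OF assms(2)] by (intro finite_subset[OF _ assms(1)]) auto
    show "C \<inter> D = {}" if "C \<in> ?C" "D \<in> ?C" "C \<noteq> D" for C D
      using that orbit_cyclic_eq3[OF cyclic] by blast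
  qed (use assms(1) in auto)
  moreover have "count (cycle_type A \<pi>) k = card ?C"
    using assms(1) by (auto simp: cycle_type_def count_image_mset' intro!: arg_cong[where f = card])
  ultimately show ?thesis by simp
qed

lemma ncycles_eq_count:
  assumes "\<pi> permutes {1..n}" "0 < k"
  shows "ncycles k n \<pi> = count (cycle_type {1..n} \<pi>) k"
  using card_points_orbit_card[OF finite_atLeastAtMost assms(1)] assms(2) by (simp add: ncycles_def)

lemma card_eq_sum_cycle_type:
  assumes "finite A" "\<pi> permutes A" "set_mset (cycle_type A \<pi>) \<subseteq> K" "finite K"
  shows "card A = (\<Sum>k\<in>K. k * count (cycle_type A \<pi>) k)"
proof -
  have "card A = (\<Sum>k\<in>K. card {i \<in> A. card (orbit \<pi> i) = k})"
    using sum.group[OF assms(1,4), of "\<lambda>i. card (orbit \<pi> i)" "\<lambda>_. 1 :: nat"] assms(1,3)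
    by (simp add: set_mset_cycle_type)
  then show ?thesis by (simp add: card_points_orbit_card[OF assms(1,2)])
qed

lemma funpow_card_orbit:
  assumes "x \<in> orbit f x"
  shows "(f ^^ card (orbit f x)) x = x"
proof -
  have "card (orbit f x) = card ((\<lambda>n. (f ^^ n) x) ` {0..<funpow_dist1 f x x})"
    by (rule arg_cong[OF orbit_conv_funpow_dist1[OF assms]])
  also have "\<dots> = funpow_dist1 f x x"
    using card_image[OF inj_on_funpow_dist1[OF assms]] by simp
  finally show ?thesis using funpow_dist1_prop[OF assms] by simp
qed

lemma card_orbit_involution:
  assumes "f (f x) = x"
  shows "card (orbit f x) = (if f x = x then 1 else 2)"
proof -
  have "orbit f x = {(f ^^ m) x | m. m < 2}"
    by (rule orbit_altdef_bounded) (simp_all add: assms numeral_2_eq_2)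
  also have "\<dots> = (\<lambda>m. (f ^^ m) x) ` {..<2}" by auto
  also have "\<dots> = {x, f x}"
    by (simp add: numeral_2_eq_2 lessThan_Suc insert_commute)
  finally show ?thesis by (auto simp: card_insert_if)
qed

lemma orbit_cycle_of_list:
  assumes "distinct cs" "x \<in> set cs"
  shows "orbit (cycle_of_list cs) x = set cs"
proof
  show "orbit (cycle_of_list cs) x \<subseteq> set cs"
    using cycle_permutes assms(2) by (rule permutes_orbit_subset)
  show "set cs \<subseteq> orbit (cycle_of_list cs) x"
  proof
    fix y assume "y \<in> set cs"
    with assms(2) obtain i j where i: "i < length cs" "x = cs ! i"
      and j: "j < length cs" "y = cs ! j"
      by (metis in_set_conv_nth)
    define m where "m = length cs + j - i"
    have "(cycle_of_list cs ^^ m) x = rotate m cs ! i"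
      using i by (simp flip: cyclic_rotation[OF assms(1)])
    also have "\<dots> = y"
      using i j by (simp add: nth_rotate m_def)
    finally show "y \<in> orbit (cycle_of_list cs) x"
      using i(1) by (auto simp: orbit_altdef m_def intro!: exI[of _ m])
  qed
qed

lemma cycle_type_cycle_of_list:
  assumes "distinct cs" "cs \<noteq> []"
  shows "cycle_type (set cs) (cycle_of_list cs) = {#length cs#}"
proof -
  have "orbit (cycle_of_list cs) ` set cs = {set cs}"
    using orbit_cycle_of_list[OF assms(1)] assms(2) by (simp add: image_constant_conv)
  then show ?thesis using assms(1) by (simp add: cycle_type_def distinct_card)
qed

section \<open>Permutations avoiding 231\<close>

definition larger_before :: "(nat \<Rightarrow> nat) \<Rightarrow> nat \<Rightarrow> nat set" where
  "larger_before \<pi> k = {i \<in> {1..<k}. \<pi> k < \<pi> i}"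

lemma avoids231_iff:
  assumes "inj \<pi>"
  shows "avoids231 n \<pi> \<longleftrightarrow> (\<forall>k\<in>{1..n}. strict_antimono_on (larger_before \<pi> k) \<pi>)"
proof
  assume av: "avoids231 n \<pi>"
  show "\<forall>k\<in>{1..n}. strict_antimono_on (larger_before \<pi> k) \<pi>"
  proof (intro ballI monotone_onI)
    fix k i j assume "k \<in> {1..n}" "i \<in> larger_before \<pi> k" "j \<in> larger_before \<pi> k" "i < j"
    then have "\<not> \<pi> i < \<pi> j" using av by (auto simp: avoids231_def larger_before_def)
    moreover have "\<pi> i \<noteq> \<pi> j" using \<open>i < j\<close> injD[OF assms] by blast
    ultimately show "\<pi> j < \<pi> i" by simp
  qed
next
  assume anti: "\<forall>k\<in>{1..n}. strict_antimono_on (larger_before \<pi> k) \<pi>"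
  show "avoids231 n \<pi>"
    unfolding avoids231_def
  proof clarify
    fix i j k assume ijk: "1 \<le> i" "i < j" "j < k" "k \<le> n" "\<pi> k < \<pi> i" "\<pi> i < \<pi> j"
    then have "i \<in> larger_before \<pi> k" "j \<in> larger_before \<pi> k" by (auto simp: larger_before_def)
    moreover have "strict_antimono_on (larger_before \<pi> k) \<pi>" using anti ijk by simp
    ultimately have "\<pi> j < \<pi> i" using \<open>i < j\<close> by (metis monotone_onD)
    then show False using ijk by simp
  qed
qed

lemma monotone_on_cong:
  "(\<And>i. i \<in> X \<Longrightarrow> f i = g i) \<Longrightarrow> monotone_on X orda ordb f \<longleftrightarrow> monotone_on X orda ordb g"
  by (simp add: monotone_on_def)

lemma strict_antimono_on_relabel:
  fixes g :: "'a::linorder \<Rightarrow> 'b::linorder"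
  assumes "strict_mono g" "\<And>i. i \<in> X \<Longrightarrow> \<pi> (g i) = g (\<sigma> i)"
  shows "strict_antimono_on (g ` X) \<pi> \<longleftrightarrow> strict_antimono_on X \<sigma>"
  using assms(2) by (auto simp: monotone_on_def strict_mono_less[OF assms(1)])

lemma S3_231_iff:
  "\<pi> \<in> S3_231 n \<longleftrightarrow>
    \<pi> permutes {1..n} \<and> avoids231 n \<pi> \<and> set_mset (cycle_type {1..n} \<pi>) \<subseteq> {1, 2, 3}"
  unfolding S3_231_def set_mset_cycle_type[OF finite_atLeastAtMost] by blast

definition cycle_counts :: "nat multiset \<Rightarrow> nat \<times> nat \<times> nat" where
  "cycle_counts T = (count T 1, count T 2, count T 3)"

definition perm_wt :: "nat \<times> (nat \<Rightarrow> nat) \<Rightarrow> nat \<times> nat \<times> nat" where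
  "perm_wt = (\<lambda>(n, \<pi>). cycle_counts (cycle_type {1..n} \<pi>))"

text \<open>The size is kept explicitly: it is not determined by the permutation, which fixes every
  point outside \<open>{1..n}\<close>.\<close>

definition avoiders :: "(nat \<times> (nat \<Rightarrow> nat)) set" where
  "avoiders = Sigma UNIV S3_231"

lemma avoiders_iff: "(n, \<pi>) \<in> avoiders \<longleftrightarrow> \<pi> \<in> S3_231 n"
  by (simp add: avoiders_def)

lemma avoiders_permutes: "(n, \<pi>) \<in> avoiders \<Longrightarrow> \<pi> permutes {1..n}"
  by (simp add: avoiders_iff S3_231_iff)

lemma avoider_decreasing_on_larger_before:
  "(n, \<pi>) \<in> avoiders \<Longrightarrow> k \<in> {1..n} \<Longrightarrow> strict_antimono_on (larger_before \<pi> k) \<pi>"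
  using avoids231_iff permutes_inj by (metis avoiders_iff S3_231_iff)

lemma avoider_decreasing_on_ge:
  assumes "(n, \<pi>) \<in> avoiders" "k \<in> {1..n}"
  shows "strict_antimono_on {i \<in> {1..k}. \<pi> k \<le> \<pi> i} \<pi>"
proof (rule monotone_onI)
  fix i j assume ij: "i \<in> {i \<in> {1..k}. \<pi> k \<le> \<pi> i}" "j \<in> {i \<in> {1..k}. \<pi> k \<le> \<pi> i}" "i < j"
  have neq: "\<pi> u \<noteq> \<pi> v" if "u \<noteq> v" for u v
    using permutes_inj[OF avoiders_permutes[OF assms(1)]] that by (simp add: inj_eq)
  have i: "i \<in> larger_before \<pi> k" using ij neq[of i k] by (simp add: larger_before_def)
  show "\<pi> j < \<pi> i"
  proof (cases "j = k")
    case True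
    then show ?thesis using i by (simp add: larger_before_def)
  next
    case False
    then have "j \<in> larger_before \<pi> k" using ij neq[of j k] by (simp add: larger_before_def)
    with i \<open>i < j\<close> show ?thesis
      using avoider_decreasing_on_larger_before[OF assms] by (metis monotone_onD)
  qed
qed

lemma avoider_decreasing_upto_1:
  assumes "(n, \<pi>) \<in> avoiders" "k \<in> {1..n}" "\<pi> k = 1"
  shows "strict_antimono_on {1..k} \<pi>"
proof -
  have "1 \<le> \<pi> i" if "i \<in> {1..k}" for i
    using that assms(2) permutes_in_image[OF avoiders_permutes[OF assms(1)], of i] by simp
  then have "{i \<in> {1..k}. \<pi> k \<le> \<pi> i} = {1..k}" using assms(3) by auto
  then show ?thesis using avoider_decreasing_on_ge[OF assms(1,2)] by simp
qed

lemma perm_wt_eq_ncycles: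
  "\<pi> permutes {1..n} \<Longrightarrow> perm_wt (n, \<pi>) = (ncycles 1 n \<pi>, ncycles 2 n \<pi>, ncycles 3 n \<pi>)"
  by (simp add: perm_wt_def cycle_counts_def ncycles_eq_count)

lemma size_eq_perm_wt:
  assumes "(n, \<pi>) \<in> avoiders" "perm_wt (n, \<pi>) = (a, b, c)"
  shows "n = a + 2 * b + 3 * c"
proof -
  have "\<pi> permutes {1..n}" "set_mset (cycle_type {1..n} \<pi>) \<subseteq> {1, 2, 3}"
    using assms(1) by (simp_all add: avoiders_iff S3_231_iff)
  then have "n = (\<Sum>k\<in>{1, 2, 3}. k * count (cycle_type {1..n} \<pi>) k)"
    using card_eq_sum_cycle_type[of "{1..n}" \<pi> "{1, 2, 3}"] by simp
  then show ?thesis using assms(2) by (simp add: perm_wt_def cycle_counts_def)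
qed

lemma finite_fibres_avoiders: "finite_fibres perm_wt avoiders"
  unfolding finite_fibres_def
proof
  fix v :: "nat \<times> nat \<times> nat"
  obtain a b c where v: "v = (a, b, c)" by (cases v)
  let ?n = "a + 2 * b + 3 * c"
  have "{u \<in> avoiders. perm_wt u = v} \<subseteq> {?n} \<times> {\<pi>. \<pi> permutes {1..?n}}"
    using size_eq_perm_wt avoiders_permutes unfolding v by fastforce
  then show "finite {u \<in> avoiders. perm_wt u = v}"
    by (rule finite_subset) (simp add: finite_permutations)
qed

lemma Bseries_eq_genfun: "Bseries = genfun perm_wt avoiders"
proof (rule fps3_eqI)
  fix a b c :: nat
  let ?n = "a + 2 * b + 3 * c"
  let ?R = "{\<pi> \<in> S3_231 ?n. ncycles 1 ?n \<pi> = a \<and> ncycles 2 ?n \<pi> = b \<and> ncycles 3 ?n \<pi> = c}"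
  have "u \<in> avoiders \<and> perm_wt u = (a, b, c) \<longleftrightarrow> u \<in> Pair ?n ` ?R" for u
  proof (cases u)
    case (Pair n \<pi>)
    then show ?thesis
      using size_eq_perm_wt[of n \<pi> a b c] perm_wt_eq_ncycles[OF avoiders_permutes, of n \<pi>]
      by (auto simp: avoiders_iff)
  qed
  then have "{u \<in> avoiders. perm_wt u = (a, b, c)} = Pair ?n ` ?R" by blast
  then show "Bseries $ c $ b $ a = genfun perm_wt avoiders $ c $ b $ a"
    by (simp add: genfun_nth Bseries_def Bcoeff_def card_image inj_on_def)
qed

section \<open>Direct sums\<close>

definition dsum :: "nat \<Rightarrow> nat \<Rightarrow> (nat \<Rightarrow> nat) \<Rightarrow> (nat \<Rightarrow> nat) \<Rightarrow> nat \<Rightarrow> nat" where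
  "dsum r s \<sigma> \<tau> = \<sigma> \<circ> map_permutation {1..s} ((+) r) \<tau>"

lemma atLeastAtMost_add_split: "{1..r + s} = {1..r} \<union> (+) r ` {1..s}" for r s :: nat
  by auto

lemma atLeastAtMost_add_disjoint: "{1..r} \<inter> (+) r ` {1..s} = {}" for r s :: nat
  by auto

lemma bij_betw_add: "bij_betw ((+) r) {1..s} ((+) r ` {1..s})" for r s :: nat
  by (simp add: bij_betw_imageI)

context
  fixes r s :: nat and \<sigma> \<tau> :: "nat \<Rightarrow> nat"
  assumes \<sigma>: "\<sigma> permutes {1..r}" and \<tau>: "\<tau> permutes {1..s}"
begin

private lemma shifted_permutes: "map_permutation {1..s} ((+) r) \<tau> permutes (+) r ` {1..s}"
  using bij_betw_add \<tau> by (rule map_permutation_permutes)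

lemma dsum_permutes: "dsum r s \<sigma> \<tau> permutes {1..r + s}"
  unfolding dsum_def atLeastAtMost_add_split
  by (rule comp_permutes_Un[OF \<sigma> shifted_permutes atLeastAtMost_add_disjoint])

lemma dsum_left: "i \<in> {1..r} \<Longrightarrow> dsum r s \<sigma> \<tau> i = \<sigma> i"
  unfolding dsum_def by (rule comp_permutes_left[OF \<sigma> shifted_permutes atLeastAtMost_add_disjoint])

lemma dsum_right:
  assumes "i \<in> {1..s}"
  shows "dsum r s \<sigma> \<tau> (r + i) = r + \<tau> i"
  using comp_permutes_right[OF \<sigma> shifted_permutes atLeastAtMost_add_disjoint, of "r + i"] assms
    map_permutation_apply[of "(+) r" "{1..s}" i \<tau>]
  by (simp add: dsum_def)

lemma dsum_left_le: "i \<in> {1..r} \<Longrightarrow> dsum r s \<sigma> \<tau> i \<le> r"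
  using permutes_in_image[OF \<sigma>, of i] by (simp add: dsum_left)

lemma dsum_right_greater: "i \<in> {1..s} \<Longrightarrow> r < dsum r s \<sigma> \<tau> (r + i)"
  using permutes_in_image[OF \<tau>, of i] by (simp add: dsum_right)

lemma cycle_type_dsum:
  "cycle_type {1..r + s} (dsum r s \<sigma> \<tau>) = cycle_type {1..r} \<sigma> + cycle_type {1..s} \<tau>"
  using cycle_type_comp[OF _ _ \<sigma> shifted_permutes atLeastAtMost_add_disjoint]
    cycle_type_map_permutation[OF _ \<tau>, of "(+) r"]
  by (simp add: dsum_def atLeastAtMost_add_split del: image_add_atLeastAtMost)

lemma larger_before_dsum_left: "k \<in> {1..r} \<Longrightarrow> larger_before (dsum r s \<sigma> \<tau>) k = larger_before \<sigma> k"
  by (auto simp: larger_before_def dsum_left)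

lemma larger_before_dsum_right:
  assumes k: "k \<in> {1..s}"
  shows "larger_before (dsum r s \<sigma> \<tau>) (r + k) = (+) r ` larger_before \<tau> k"
proof -
  have "i \<notin> larger_before (dsum r s \<sigma> \<tau>) (r + k)" if "i \<in> {1..r}" for i
    using dsum_left_le[OF that] dsum_right_greater[OF k] by (simp add: larger_before_def)
  moreover have "r + i \<in> larger_before (dsum r s \<sigma> \<tau>) (r + k) \<longleftrightarrow> i \<in> larger_before \<tau> k"
    if "i \<in> {1..s}" for i
    using that k by (auto simp: larger_before_def dsum_right)
  moreover have "larger_before (dsum r s \<sigma> \<tau>) (r + k) \<subseteq> {1..r} \<union> (+) r ` {1..s}"
    unfolding atLeastAtMost_add_split[symmetric] using k by (auto simp: larger_before_def)
  moreover have "larger_before \<tau> k \<subseteq> {1..s}" using k by (auto simp: larger_before_def)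
  ultimately show ?thesis by blast
qed

lemma avoids231_dsum: "avoids231 (r + s) (dsum r s \<sigma> \<tau>) \<longleftrightarrow> avoids231 r \<sigma> \<and> avoids231 s \<tau>"
proof -
  let ?\<pi> = "dsum r s \<sigma> \<tau>"
  have left: "strict_antimono_on (larger_before ?\<pi> k) ?\<pi> \<longleftrightarrow> strict_antimono_on (larger_before \<sigma> k) \<sigma>"
    if "k \<in> {1..r}" for k
    unfolding larger_before_dsum_left[OF that]
    by (rule monotone_on_cong) (use that in \<open>auto simp: larger_before_def dsum_left\<close>)
  have right: "strict_antimono_on (larger_before ?\<pi> (r + k)) ?\<pi> \<longleftrightarrow>
      strict_antimono_on (larger_before \<tau> k) \<tau>" if "k \<in> {1..s}" for k
    unfolding larger_before_dsum_right[OF that]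
    by (rule strict_antimono_on_relabel)
      (use that in \<open>auto simp: larger_before_def dsum_right strict_mono_def\<close>)
  show ?thesis
    unfolding avoids231_iff[OF permutes_inj[OF \<sigma>]] avoids231_iff[OF permutes_inj[OF \<tau>]]
      avoids231_iff[OF permutes_inj[OF dsum_permutes]] atLeastAtMost_add_split
    by (simp add: ball_Un left right del: image_add_atLeastAtMost)
qed

lemma dsum_in_avoiders: "(r + s, dsum r s \<sigma> \<tau>) \<in> avoiders \<longleftrightarrow> (r, \<sigma>) \<in> avoiders \<and> (s, \<tau>) \<in> avoiders"
  using dsum_permutes \<sigma> \<tau> by (auto simp: avoiders_iff S3_231_iff avoids231_dsum cycle_type_dsum)

lemma perm_wt_dsum: "perm_wt (r + s, dsum r s \<sigma> \<tau>) = perm_wt (r, \<sigma>) + perm_wt (s, \<tau>)"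
  by (simp add: perm_wt_def cycle_type_dsum cycle_counts_def)

end

lemma dsum_inject:
  assumes "\<sigma> permutes {1..r}" "\<tau> permutes {1..s}" "\<sigma>' permutes {1..r}" "\<tau>' permutes {1..s}"
    and eq: "dsum r s \<sigma> \<tau> = dsum r s \<sigma>' \<tau>'"
  shows "\<sigma> = \<sigma>' \<and> \<tau> = \<tau>'"
proof
  have "\<sigma> i = \<sigma>' i" if "i \<in> {1..r}" for i
    using dsum_left[OF assms(1,2) that] dsum_left[OF assms(3,4) that] eq by simp
  then show "\<sigma> = \<sigma>'" using assms(1,3) by (metis ext permutes_not_in)
  have "\<tau> i = \<tau>' i" if "i \<in> {1..s}" for i
    using dsum_right[OF assms(1,2) that] dsum_right[OF assms(3,4) that] eq by simp
  then show "\<tau> = \<tau>'" using assms(2,4) by (metis ext permutes_not_in)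
qed

lemma dsumE:
  assumes \<pi>: "\<pi> permutes {1..r + s}" and into: "\<pi> ` {1..r} \<subseteq> {1..r}"
  obtains \<sigma> \<tau> where "\<sigma> permutes {1..r}" "\<tau> permutes {1..s}" "\<pi> = dsum r s \<sigma> \<tau>"
proof -
  obtain \<sigma> \<beta> where \<sigma>: "\<sigma> permutes {1..r}" and \<beta>: "\<beta> permutes (+) r ` {1..s}" "\<pi> = \<sigma> \<circ> \<beta>"
    using permutes_Un_invariantE[OF \<pi>[unfolded atLeastAtMost_add_split]
        atLeastAtMost_add_disjoint finite_atLeastAtMost into] .
  moreover obtain \<tau> where "\<tau> permutes {1..s}" "\<beta> = map_permutation {1..s} ((+) r) \<tau>"
    using permutes_imageE[OF \<beta>(1)] by auto
  ultimately show thesis using that unfolding dsum_def by blast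
qed

section \<open>Splitting at the maximum\<close>

definition max_first :: "(nat \<times> (nat \<Rightarrow> nat)) set" where
  "max_first = {(n, \<pi>) \<in> avoiders. 1 \<le> n \<and> \<pi> 1 = n}"

lemma max_first_iff: "(n, \<pi>) \<in> max_first \<longleftrightarrow> (n, \<pi>) \<in> avoiders \<and> 1 \<le> n \<and> \<pi> 1 = n"
  by (simp add: max_first_def)

lemma permutes_prefix_invariant:
  fixes \<pi> :: "nat \<Rightarrow> nat"
  assumes \<pi>: "\<pi> permutes {1..n}" and "r \<le> n"
    and less: "\<And>i l. i \<in> {1..r} \<Longrightarrow> l \<in> {r + 1..n} \<Longrightarrow> \<pi> i < \<pi> l"
  shows "\<pi> ` {1..r} \<subseteq> {1..r}"
proof (rule image_subsetI)
  fix i assume i: "i \<in> {1..r}"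
  have mem: "\<pi> j \<in> {1..n}" if "j \<in> {1..n}" for j using permutes_in_image[OF \<pi>] that by blast
  have "\<pi> ` {r + 1..n} \<subseteq> {\<pi> i + 1..n}" using less[OF i] mem \<open>r \<le> n\<close> by fastforce
  then have "card (\<pi> ` {r + 1..n}) \<le> card {\<pi> i + 1..n}" by (rule card_mono[rotated]) simp
  then have "n - r \<le> n - \<pi> i" by (simp add: card_image permutes_inj_on[OF \<pi>])
  then show "\<pi> i \<in> {1..r}" using mem[of i] i \<open>r \<le> n\<close> by auto
qed

lemma avoider_before_max_less:
  assumes "(n, \<pi>) \<in> avoiders" "q \<in> {1..n}" "\<pi> q = n" "i \<in> {1..<q}" "l \<in> {q..n}"
  shows "\<pi> i < \<pi> l"
proof (rule ccontr)
  have \<pi>: "\<pi> permutes {1..n}" using assms(1) by (rule avoiders_permutes)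
  have inj: "\<pi> u \<noteq> \<pi> v" if "u \<noteq> v" for u v
    using permutes_inj[OF \<pi>] that by (simp add: inj_eq)
  have "\<pi> i \<in> {1..n}" using permutes_in_image[OF \<pi>, of i] assms(2,4) by simp
  then have less: "\<pi> i < \<pi> q" using inj[of i q] assms(3,4) by simp
  assume "\<not> \<pi> i < \<pi> l"
  then have "\<pi> l < \<pi> i" using inj[of l i] assms(4,5) by simp
  moreover from this less have "q < l" using assms(5) by (cases "l = q") auto
  ultimately have "i \<in> larger_before \<pi> l" "q \<in> larger_before \<pi> l"
    using less assms(2,4) by (auto simp: larger_before_def)
  then have "\<pi> q < \<pi> i"
    using avoider_decreasing_on_larger_before[OF assms(1), of l] assms(2,4,5)
    by (auto dest: monotone_onD)
  with less show False by simp
qed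

lemma avoiders_dsumE:
  assumes "(n, \<pi>) \<in> avoiders" "1 \<le> n"
  obtains r \<sigma> s \<tau> where "n = r + s" "\<pi> = dsum r s \<sigma> \<tau>" "(r, \<sigma>) \<in> avoiders" "(s, \<tau>) \<in> max_first"
proof -
  have \<pi>: "\<pi> permutes {1..n}" using assms(1) by (rule avoiders_permutes)
  have "n \<in> \<pi> ` {1..n}" using permutes_image[OF \<pi>] assms(2) by simp
  then obtain q where q: "q \<in> {1..n}" "\<pi> q = n" by auto
  define r s where "r = q - 1" and "s = n - r"
  have n: "n = r + s" and q_eq: "q = r + 1" and s: "1 \<le> s" using q(1) by (auto simp: r_def s_def)
  have "\<pi> ` {1..r} \<subseteq> {1..r}"
    using avoider_before_max_less[OF assms(1) q] q(1) q_eq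
    by (intro permutes_prefix_invariant[OF \<pi>]) auto
  then obtain \<sigma> \<tau> where \<sigma>\<tau>: "\<sigma> permutes {1..r}" "\<tau> permutes {1..s}" "\<pi> = dsum r s \<sigma> \<tau>"
    using dsumE \<pi> unfolding n by metis
  have "\<tau> 1 = s" using dsum_right[OF \<sigma>\<tau>(1,2), of 1] s q(2) by (simp add: n q_eq \<sigma>\<tau>(3))
  then show thesis
    using that[OF n \<sigma>\<tau>(3)] assms(1) s dsum_in_avoiders[OF \<sigma>\<tau>(1,2)]
    by (simp add: n \<sigma>\<tau>(3) max_first_iff)
qed

lemma dsum_max_first_inject:
  assumes "(r, \<sigma>) \<in> avoiders" "(s, \<tau>) \<in> max_first" "(r', \<sigma>') \<in> avoiders" "(s', \<tau>') \<in> max_first"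
    and size: "r + s = r' + s'" and eq: "dsum r s \<sigma> \<tau> = dsum r' s' \<sigma>' \<tau>'"
  shows "r = r' \<and> \<sigma> = \<sigma>' \<and> s = s' \<and> \<tau> = \<tau>'"
proof -
  have perm: "\<sigma> permutes {1..r}" "\<tau> permutes {1..s}" "\<sigma>' permutes {1..r'}" "\<tau>' permutes {1..s'}"
    using assms(1-4) by (auto simp: max_first_iff avoiders_permutes)
  have "dsum r s \<sigma> \<tau> (r + 1) = dsum r s \<sigma> \<tau> (r' + 1)"
    using assms(2,4) dsum_right[OF perm(1,2), of 1] dsum_right[OF perm(3,4), of 1] size
    by (simp add: max_first_iff eq)
  then have "r = r'" using permutes_inj[OF dsum_permutes[OF perm(1,2)]] by (simp add: inj_eq)
  with size have "s = s'" by simp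
  then show ?thesis using \<open>r = r'\<close> dsum_inject[OF perm(1,2)] perm(3,4) eq by simp
qed

lemma bij_betw_dsum:
  "bij_betw (\<lambda>((r, \<sigma>), (s, \<tau>)). (r + s, dsum r s \<sigma> \<tau>)) (avoiders \<times> max_first)
    {(n, \<pi>) \<in> avoiders. 1 \<le> n}"
  (is "bij_betw ?f ?S ?T")
proof (rule bij_betw_imageI)
  show "inj_on ?f ?S"
    using dsum_max_first_inject by (auto simp: inj_on_def)
  have "?f u \<in> ?T" if "u \<in> ?S" for u
    using that dsum_in_avoiders[OF avoiders_permutes avoiders_permutes]
    by (auto simp: max_first_iff)
  moreover have "v \<in> ?f ` ?S" if "v \<in> ?T" for v
  proof -
    from that obtain n \<pi> where v: "v = (n, \<pi>)" "(n, \<pi>) \<in> avoiders" "1 \<le> n" by auto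
    from v(2,3) obtain r \<sigma> s \<tau> where "n = r + s" "\<pi> = dsum r s \<sigma> \<tau>"
      "(r, \<sigma>) \<in> avoiders" "(s, \<tau>) \<in> max_first"
      by (rule avoiders_dsumE)
    then show ?thesis unfolding v(1) by (auto intro!: image_eqI[of _ _ "((r, \<sigma>), (s, \<tau>))"])
  qed
  ultimately show "?f ` ?S = ?T" by (intro equalityI image_subsetI subsetI)
qed

lemma finite_fibres_max_first: "finite_fibres perm_wt max_first"
  by (rule finite_fibres_subset[OF finite_fibres_avoiders]) (auto simp: max_first_def)

lemma genfun_avoiders:
  "genfun perm_wt avoiders = 1 + genfun perm_wt avoiders * genfun perm_wt max_first"
proof -
  let ?T = "{(n, \<pi>) \<in> avoiders. 1 \<le> n}"
  have "u \<in> avoiders \<longleftrightarrow> u \<in> {(0, id)} \<union> ?T" for u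
    by (cases u; cases "fst u") (auto simp: avoiders_iff S3_231_iff avoids231_def cycle_type_def)
  then have split: "avoiders = {(0, id)} \<union> ?T" by blast
  then have "genfun perm_wt avoiders = genfun perm_wt {(0, id)} + genfun perm_wt ?T"
    using genfun_Un[of perm_wt "{(0, id)}" ?T] finite_fibres_avoiders by simp
  also have "genfun perm_wt {(0, id)} = 1"
    by (simp add: genfun_singleton perm_wt_def cycle_counts_def cycle_type_def monomial_def)
  also have "genfun perm_wt ?T =
      genfun (\<lambda>u. perm_wt (fst u) + perm_wt (snd u)) (avoiders \<times> max_first)"
    by (rule genfun_bij_betw[OF bij_betw_dsum])
      (auto simp: perm_wt_dsum avoiders_permutes max_first_iff)
  also have "\<dots> = genfun perm_wt avoiders * genfun perm_wt max_first"
    by (rule genfun_Times[OF finite_fibres_avoiders finite_fibres_max_first])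
  finally show ?thesis .
qed

section \<open>Decreasing permutations\<close>

definition reversal :: "nat \<Rightarrow> nat \<Rightarrow> nat" where
  "reversal n i = (if i \<in> {1..n} then n + 1 - i else i)"

lemma reversal_reversal: "reversal n (reversal n i) = i"
  by (auto simp: reversal_def)

lemma reversal_permutes: "reversal n permutes {1..n}"
proof (rule bij_imp_permutes)
  show "bij_betw (reversal n) {1..n} {1..n}"
    by (rule bij_betw_byWitness[where f' = "reversal n"]) (auto simp: reversal_def)
qed (auto simp: reversal_def)

lemma strict_antimono_on_reversal: "strict_antimono_on {1..n} (reversal n)"
  by (auto simp: monotone_on_def reversal_def)

lemma strict_antimono_on_iff_reversal:
  assumes \<pi>: "\<pi> permutes {1..n}"
  shows "strict_antimono_on {1..n} \<pi> \<longleftrightarrow> \<pi> = reversal n"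
proof
  assume anti: "strict_antimono_on {1..n} \<pi>"
  have perm: "\<pi> \<circ> reversal n permutes {1..n}" by (rule permutes_compose[OF reversal_permutes \<pi>])
  have mono: "strict_mono_on {1..n} (\<pi> \<circ> reversal n)"
    by (rule strict_mono_onI) (auto simp: reversal_def intro!: monotone_onD[OF anti])
  have "i \<le> n \<Longrightarrow> i \<le> (\<pi> \<circ> reversal n) i" for i
  proof (induction i)
    case (Suc i)
    show ?case
    proof (cases "i = 0")
      case True
      then show ?thesis
        using Suc.prems permutes_in_image[OF perm, of "Suc i"] by (simp flip: One_nat_def)
    next
      case False
      then have "(\<pi> \<circ> reversal n) i < (\<pi> \<circ> reversal n) (Suc i)"
        using Suc.prems by (intro strict_mono_onD[OF mono]) auto
      then show ?thesis using Suc by simp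
    qed
  qed simp
  then have "\<pi> \<circ> reversal n = id" using permutes_natset_ge[OF perm] by simp
  then show "\<pi> = reversal n" by (metis comp_apply ext id_apply reversal_reversal)
qed (simp add: strict_antimono_on_reversal)

lemma card_orbit_reversal:
  "i \<in> {1..n} \<Longrightarrow> card (orbit (reversal n) i) = (if 2 * i = n + 1 then 1 else 2)"
  by (subst card_orbit_involution) (auto simp: reversal_reversal, auto simp: reversal_def)

lemma reversal_in_avoiders: "(n, reversal n) \<in> avoiders"
proof -
  have "strict_antimono_on (larger_before (reversal n) k) (reversal n)" if "k \<in> {1..n}" for k
    using strict_antimono_on_reversal
    by (rule monotone_on_subset) (use that in \<open>auto simp: larger_before_def\<close>)
  then show ?thesis
    using avoids231_iff[OF permutes_inj[OF reversal_permutes]] reversal_permutes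
    by (auto simp: avoiders_iff S3_231_iff set_mset_cycle_type card_orbit_reversal)
qed

definition reversal_wt :: "nat \<Rightarrow> nat \<times> nat \<times> nat" where
  "reversal_wt n = (n mod 2, n div 2, 0)"

lemma perm_wt_reversal: "perm_wt (n, reversal n) = reversal_wt n"
proof -
  have points: "{i \<in> {1..n}. card (orbit (reversal n) i) = k} =
      {i \<in> {1..n}. (if 2 * i = n + 1 then 1 else 2) = k}" for k
    using card_orbit_reversal by auto
  have mid: "{i. 2 * i = n + 1} = (if odd n then {(n + 1) div 2} else {})"
    by (auto elim!: oddE) presburger
  have "ncycles 1 n (reversal n) = n mod 2"
    unfolding ncycles_def points using mid by (simp add: odd_iff_mod_2_eq_one)
  moreover have "ncycles 3 n (reversal n) = 0"
    unfolding ncycles_def points by simp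
  moreover have "n = ncycles 1 n (reversal n) + 2 * ncycles 2 n (reversal n) +
      3 * ncycles 3 n (reversal n)"
    by (rule size_eq_perm_wt[OF reversal_in_avoiders perm_wt_eq_ncycles[OF reversal_permutes]])
  ultimately show ?thesis
    by (simp add: perm_wt_eq_ncycles[OF reversal_permutes] reversal_wt_def)
qed

lemma finite_fibres_reversal_wt: "finite_fibres reversal_wt S"
  unfolding finite_fibres_def
proof
  fix v
  have "{n \<in> S. reversal_wt n = v} \<subseteq> {fst v + 2 * fst (snd v)}"
    by (auto simp: reversal_wt_def)
  then show "finite {n \<in> S. reversal_wt n = v}" by (rule finite_subset) simp
qed

lemma reversal_wt_add_2: "reversal_wt (n + 2) = reversal_wt n + (0, 1, 0)"
  by (simp add: reversal_wt_def)

lemma genfun_reversal_wt_ge_1: "genfun reversal_wt {1..} = genfun reversal_wt UNIV - 1"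
proof -
  have "UNIV = {0} \<union> {1::nat..}" by auto
  then have "genfun reversal_wt UNIV = genfun reversal_wt {0} + genfun reversal_wt {1..}"
    using genfun_Un[OF finite_fibres_reversal_wt, of "{0}" "{1..}"] by simp
  then show ?thesis by (simp add: genfun_singleton reversal_wt_def monomial_def)
qed

lemma affine_fixed_point_iff:
  fixes a c z :: "'a :: comm_ring_1"
  shows "z * (1 - c) = a \<longleftrightarrow> z = a + z * c"
  by (simp add: right_diff_distrib diff_eq_eq)

lemma genfun_reversal_wt: "genfun reversal_wt UNIV * (1 - varX) = 1 + varT"
proof -
  have bij: "bij_betw (\<lambda>n. n + 2) UNIV {2::nat..}"
    by (rule bij_betw_byWitness[where f' = "\<lambda>n. n - 2"]) auto
  have "UNIV = {0} \<union> ({1} \<union> {2::nat..})" by auto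
  then have "genfun reversal_wt UNIV = genfun reversal_wt ({0} \<union> ({1} \<union> {2..}))" by simp
  also have "\<dots> = genfun reversal_wt {0} + (genfun reversal_wt {1} + genfun reversal_wt {2..})"
    by (rule genfun_Un3[OF finite_fibres_reversal_wt]) auto
  also have "genfun reversal_wt {2..} = genfun (\<lambda>n. reversal_wt n + (0, 1, 0)) UNIV"
    by (rule genfun_bij_betw[OF bij]) (rule reversal_wt_add_2)
  also have "\<dots> = genfun reversal_wt UNIV * varX"
    by (simp add: genfun_shift[OF finite_fibres_reversal_wt] monomial_def)
  also have "genfun reversal_wt {0} = 1"
    by (simp add: genfun_singleton reversal_wt_def monomial_def)
  also have "genfun reversal_wt {1} = varT"
    by (simp add: genfun_singleton reversal_wt_def monomial_def)
  finally show ?thesis unfolding affine_fixed_point_iff add.assoc .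
qed

definition triangle :: "(nat \<times> nat) set" where
  "triangle = (SIGMA n:UNIV. {0..n})"

lemma genfun_triangle:
  "genfun (\<lambda>u. reversal_wt (fst u)) triangle * (1 - varX) = 2 * genfun reversal_wt UNIV - 1"
proof -
  let ?W = "\<lambda>u :: nat \<times> nat. reversal_wt (fst u)"
  let ?row0 = "SIGMA n:UNIV. {0}" and ?row1 = "SIGMA n:{1..}. {1}"
    and ?rest = "SIGMA n:{2::nat..}. {2..n}"
  have fin: "finite_fibres ?W triangle"
    unfolding triangle_def by (rule finite_fibres_Sigma[OF finite_fibres_reversal_wt]) simp
  have bij: "bij_betw (\<lambda>(n, p). (n + 2, p + 2)) triangle ?rest"
    unfolding triangle_def
    by (rule bij_betw_byWitness[where f' = "\<lambda>(n, p). (n - 2, p - 2)"]) auto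
  have split: "triangle = ?row0 \<union> (?row1 \<union> ?rest)" by (auto simp: triangle_def)
  have "genfun ?W triangle = genfun ?W ?row0 + (genfun ?W ?row1 + genfun ?W ?rest)"
    unfolding split by (rule genfun_Un3[OF fin[unfolded split]]) auto
  also have "genfun ?W ?row0 = genfun reversal_wt UNIV"
    using genfun_Sigma_card[OF finite_fibres_reversal_wt, of UNIV "\<lambda>_. {0}" 1] by simp
  also have "genfun ?W ?row1 = genfun reversal_wt UNIV - 1"
    using genfun_Sigma_card[OF finite_fibres_reversal_wt, of "{1..}" "\<lambda>_. {1}" 1]
    by (simp add: genfun_reversal_wt_ge_1)
  also have "genfun ?W ?rest = genfun (\<lambda>u. ?W u + (0, 1, 0)) triangle"
    by (rule genfun_bij_betw[OF bij]) (auto simp: reversal_wt_add_2)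
  also have "\<dots> = genfun ?W triangle * varX"
    by (simp add: genfun_shift[OF fin] monomial_def)
  also have "genfun reversal_wt UNIV + (genfun reversal_wt UNIV - 1 + genfun ?W triangle * varX) =
      2 * genfun reversal_wt UNIV - 1 + genfun ?W triangle * varX"
    by simp
  finally show ?thesis unfolding affine_fixed_point_iff .
qed

section \<open>Permutations beginning with their maximum\<close>

definition outer_3cycle :: "(nat \<times> (nat \<Rightarrow> nat)) set" where
  "outer_3cycle = {(n, \<pi>) \<in> avoiders. 1 < \<pi> n \<and> \<pi> n < n \<and> \<pi> 1 = n \<and> \<pi> (\<pi> n) = 1}"

lemma outer_3cycle_iff:
  "(n, \<pi>) \<in> outer_3cycle \<longleftrightarrow>
    (n, \<pi>) \<in> avoiders \<and> 1 < \<pi> n \<and> \<pi> n < n \<and> \<pi> 1 = n \<and> \<pi> (\<pi> n) = 1"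
  by (simp add: outer_3cycle_def)

lemma reversal_not_in_outer_3cycle: "(n, reversal n) \<notin> outer_3cycle"
  by (auto simp: outer_3cycle_iff reversal_def)

lemma max_first_cases:
  assumes "(n, \<pi>) \<in> max_first"
  shows "\<pi> = reversal n \<or> (n, \<pi>) \<in> outer_3cycle"
proof (cases "\<pi> n = 1")
  case True
  then show ?thesis
    using assms avoider_decreasing_upto_1[of n \<pi> n] strict_antimono_on_iff_reversal[of \<pi> n]
    by (simp add: max_first_iff avoiders_permutes)
next
  case False
  have av: "(n, \<pi>) \<in> avoiders" and n: "1 \<le> n" "\<pi> 1 = n" using assms by (simp_all add: max_first_iff)
  have \<pi>: "\<pi> permutes {1..n}" using av by (rule avoiders_permutes)
  have "n \<noteq> 1" using False n by auto
  then have "\<pi> n \<noteq> n" using permutes_inj[OF \<pi>] n(2) by (metis injD)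
  moreover have "\<pi> n \<in> {1..n}" using permutes_in_image[OF \<pi>] n(1) by simp
  ultimately have "1 < \<pi> n" "\<pi> n < n" using False by auto
  moreover have "\<pi> (\<pi> n) = 1"
  proof -
    have "card (orbit \<pi> 1) \<in> {1, 2, 3}" using av n(1) by (auto simp: avoiders_iff S3_231_def)
    moreover have "(\<pi> ^^ card (orbit \<pi> 1)) 1 = 1"
      by (rule funpow_card_orbit[OF permutes_self_in_orbit[OF finite_atLeastAtMost \<pi>]])
    ultimately show ?thesis
      using False \<open>n \<noteq> 1\<close> n(2) by (auto simp: eval_nat_numeral One_nat_def)
  qed
  ultimately show ?thesis using av n(2) by (simp add: outer_3cycle_iff)
qed

lemma genfun_max_first:
  "genfun perm_wt max_first = genfun reversal_wt UNIV - 1 + genfun perm_wt outer_3cycle"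
proof -
  let ?R = "(\<lambda>n. (n, reversal n)) ` {1..}"
  have "u \<in> max_first \<longleftrightarrow> u \<in> ?R \<union> outer_3cycle" for u
    using max_first_cases[of "fst u" "snd u"] reversal_in_avoiders
    by (cases u) (auto simp: max_first_iff outer_3cycle_iff reversal_def)
  then have split: "max_first = ?R \<union> outer_3cycle" by blast
  have "genfun perm_wt max_first = genfun perm_wt ?R + genfun perm_wt outer_3cycle"
    unfolding split
    by (rule genfun_Un)
      (use finite_fibres_max_first reversal_not_in_outer_3cycle in \<open>auto simp: split\<close>)
  also have "genfun perm_wt ?R = genfun reversal_wt {1..}"
    by (subst genfun_image) (simp_all add: inj_on_def perm_wt_reversal)
  finally show ?thesis unfolding genfun_reversal_wt_ge_1 .
qed

section \<open>Inserting a 3-cycle\<close>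

text \<open>The heights at which a 3-cycle can be wrapped around \<open>\<sigma>\<close>: the new entry 1 is placed right
  after the first \<open>p\<close> entries, which must therefore decrease, and the new last entry lies just above
  the value \<open>p\<close>, so the entries exceeding \<open>p\<close> must decrease as well.\<close>

definition cut_heights :: "nat \<Rightarrow> (nat \<Rightarrow> nat) \<Rightarrow> nat set" where
  "cut_heights r \<sigma> = {p \<in> {0..r}. strict_antimono_on {1..p} \<sigma> \<and>
     strict_antimono_on {i \<in> {1..r}. p < \<sigma> i} \<sigma>}"

definition cuts :: "(nat \<times> (nat \<Rightarrow> nat)) set \<Rightarrow> ((nat \<times> (nat \<Rightarrow> nat)) \<times> nat) set" where
  "cuts S = Sigma S (\<lambda>(r, \<sigma>). cut_heights r \<sigma>)"

lemma cut_heights_le: "p \<in> cut_heights r \<sigma> \<Longrightarrow> p \<le> r"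
  by (simp add: cut_heights_def)

lemma finite_cut_heights: "finite (cut_heights n \<pi>)"
  by (simp add: cut_heights_def)

lemma cuts_iff: "((r, \<sigma>), p) \<in> cuts S \<longleftrightarrow> (r, \<sigma>) \<in> S \<and> p \<in> cut_heights r \<sigma>"
  by (simp add: cuts_def)

lemma finite_fibres_cuts: "finite_fibres W S \<Longrightarrow> finite_fibres (\<lambda>u. W (fst u)) (cuts S)"
  unfolding cuts_def by (rule finite_fibres_Sigma) (auto simp: finite_cut_heights)

definition skip :: "nat \<Rightarrow> nat \<Rightarrow> nat" where
  "skip p i = (if i \<le> p then i + 1 else i + 2)"

lemma strict_mono_skip: "strict_mono (skip p)"
  by (auto simp: strict_mono_def skip_def)

lemma inj_on_skip: "inj_on (skip p) A"
  using strict_mono_skip strict_mono_imp_inj_on by (blast intro: inj_on_subset)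

lemma skip_image:
  assumes "p \<le> r"
  shows "skip p ` {1..r} = {1..r + 3} - {1, r + 3, p + 2}"
proof (intro equalityI subsetI)
  fix u assume u: "u \<in> {1..r + 3} - {1, r + 3, p + 2}"
  have "u = skip p (if u < p + 2 then u - 1 else u - 2)" using u by (auto simp: skip_def)
  moreover have "(if u < p + 2 then u - 1 else u - 2) \<in> {1..r}" using u assms by auto
  ultimately show "u \<in> skip p ` {1..r}" by blast
qed (use assms in \<open>auto simp: skip_def\<close>)

definition insert3 :: "nat \<Rightarrow> nat \<Rightarrow> (nat \<Rightarrow> nat) \<Rightarrow> nat \<Rightarrow> nat" where
  "insert3 r p \<sigma> = map_permutation {1..r} (skip p) \<sigma> \<circ> cycle_of_list [1, r + 3, p + 2]"

context
  fixes r p :: nat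
  assumes p: "p \<le> r"
begin

lemma skip_split: "{1..r + 3} = skip p ` {1..r} \<union> set [1, r + 3, p + 2]"
  unfolding skip_image[OF p] using p by auto

lemma skip_disjoint: "skip p ` {1..r} \<inter> set [1, r + 3, p + 2] = {}"
  unfolding skip_image[OF p] by auto

context
  fixes \<sigma> :: "nat \<Rightarrow> nat"
  assumes \<sigma>: "\<sigma> permutes {1..r}"
begin

private lemma relabelled_permutes: "map_permutation {1..r} (skip p) \<sigma> permutes skip p ` {1..r}"
  using inj_on_skip \<sigma> by (intro map_permutation_permutes) (simp_all add: bij_betw_imageI)

lemma insert3_permutes: "insert3 r p \<sigma> permutes {1..r + 3}"
  unfolding insert3_def skip_split
  by (rule comp_permutes_Un[OF relabelled_permutes cycle_permutes skip_disjoint])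

lemma insert3_skip: "i \<in> {1..r} \<Longrightarrow> insert3 r p \<sigma> (skip p i) = skip p (\<sigma> i)"
  using comp_permutes_left[OF relabelled_permutes cycle_permutes skip_disjoint, of "skip p i"]
  by (simp add: insert3_def map_permutation_apply[OF inj_on_skip]
      del: comp_apply cycle_of_list.simps)

lemma insert3_cycle:
  "insert3 r p \<sigma> 1 = r + 3" "insert3 r p \<sigma> (r + 3) = p + 2" "insert3 r p \<sigma> (p + 2) = 1"
proof -
  have "insert3 r p \<sigma> x = cycle_of_list [1, r + 3, p + 2] x" if "x \<in> {1, r + 3, p + 2}" for x
    unfolding insert3_def
    by (rule comp_permutes_right[OF relabelled_permutes cycle_permutes skip_disjoint])
      (use that in simp)
  then show "insert3 r p \<sigma> 1 = r + 3" "insert3 r p \<sigma> (r + 3) = p + 2" "insert3 r p \<sigma> (p + 2) = 1"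
    using p by (simp_all add: transpose_def)
qed

lemma cycle_type_insert3: "cycle_type {1..r + 3} (insert3 r p \<sigma>) = cycle_type {1..r} \<sigma> + {#3#}"
proof -
  have "cycle_type {1..r + 3} (insert3 r p \<sigma>) =
      cycle_type (skip p ` {1..r}) (map_permutation {1..r} (skip p) \<sigma>) +
      cycle_type (set [1, r + 3, p + 2]) (cycle_of_list [1, r + 3, p + 2])"
    unfolding insert3_def skip_split
    by (rule cycle_type_comp[OF _ _ relabelled_permutes cycle_permutes skip_disjoint]) simp_all
  also have "cycle_type (skip p ` {1..r}) (map_permutation {1..r} (skip p) \<sigma>) = cycle_type {1..r} \<sigma>"
    using \<sigma> inj_on_skip by (simp add: cycle_type_map_permutation)
  also have "cycle_type (set [1, r + 3, p + 2]) (cycle_of_list [1, r + 3, p + 2]) =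
      {#length [1, r + 3, p + 2]#}"
    by (rule cycle_type_cycle_of_list) (use p in auto)
  finally show ?thesis by simp
qed

lemma perm_wt_insert3: "perm_wt (r + 3, insert3 r p \<sigma>) = perm_wt (r, \<sigma>) + (0, 0, 1)"
  by (simp add: perm_wt_def cycle_type_insert3 cycle_counts_def)

lemma larger_before_insert3:
  assumes "k \<in> {2..r + 3}"
  shows "larger_before (insert3 r p \<sigma>) k =
    insert 1 (skip p ` {i \<in> {1..r}. skip p i < k \<and> insert3 r p \<sigma> k < skip p (\<sigma> i)})"
    (is "_ = insert 1 (skip p ` ?X)")
proof -
  let ?\<pi> = "insert3 r p \<sigma>"
  have \<pi>k: "?\<pi> k \<in> {1..r + 3}" using permutes_in_image[OF insert3_permutes, of k] assms by simp
  have "?\<pi> k \<noteq> ?\<pi> 1" using assms permutes_inj[OF insert3_permutes] by (simp add: inj_eq)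
  then have "1 \<in> larger_before ?\<pi> k" using \<pi>k assms by (simp add: larger_before_def insert3_cycle)
  moreover have "p + 2 \<notin> larger_before ?\<pi> k" "r + 3 \<notin> larger_before ?\<pi> k"
    using \<pi>k assms by (auto simp: larger_before_def insert3_cycle)
  moreover have "larger_before ?\<pi> k \<subseteq> skip p ` {1..r} \<union> {1, r + 3, p + 2}"
    using assms skip_split by (auto simp: larger_before_def)
  moreover have "skip p i \<in> larger_before ?\<pi> k \<longleftrightarrow> i \<in> ?X" if "i \<in> {1..r}" for i
    using that by (auto simp: larger_before_def insert3_skip, auto simp: skip_def)
  ultimately show ?thesis by auto
qed

lemma strict_antimono_on_insert3:
  assumes X: "X \<subseteq> {1..r}"
  shows "strict_antimono_on (insert 1 (skip p ` X)) (insert3 r p \<sigma>) \<longleftrightarrow> strict_antimono_on X \<sigma>"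
proof -
  let ?\<pi> = "insert3 r p \<sigma>"
  have "?\<pi> (skip p i) < ?\<pi> 1" if "i \<in> X" for i
  proof -
    have i: "i \<in> {1..r}" using that X by blast
    then have "skip p (\<sigma> i) < r + 3"
      using permutes_in_image[OF \<sigma>, of i] by (simp add: skip_def)
    then show ?thesis by (simp add: insert3_skip[OF i] insert3_cycle)
  qed
  moreover have "1 < skip p i" if "i \<in> X" for i using that X by (auto simp: skip_def)
  ultimately have "strict_antimono_on (insert 1 (skip p ` X)) ?\<pi> \<longleftrightarrow>
      strict_antimono_on (skip p ` X) ?\<pi>"
    by (fastforce simp: monotone_on_def)
  also have "\<dots> \<longleftrightarrow> strict_antimono_on X \<sigma>"
    using strict_mono_skip by (rule strict_antimono_on_relabel) (use X insert3_skip in blast)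
  finally show ?thesis .
qed

lemma strict_antimono_on_larger_before_insert3:
  "k \<in> {2..r + 3} \<Longrightarrow>
    strict_antimono_on (larger_before (insert3 r p \<sigma>) k) (insert3 r p \<sigma>) \<longleftrightarrow>
    strict_antimono_on {i \<in> {1..r}. skip p i < k \<and> insert3 r p \<sigma> k < skip p (\<sigma> i)} \<sigma>"
  unfolding larger_before_insert3 by (rule strict_antimono_on_insert3) auto

lemma avoids231_insert3:
  "avoids231 (r + 3) (insert3 r p \<sigma>) \<longleftrightarrow> avoids231 r \<sigma> \<and> p \<in> cut_heights r \<sigma>"
proof -
  let ?\<pi> = "insert3 r p \<sigma>"
  have "larger_before ?\<pi> 1 = {}" by (simp add: larger_before_def)
  then have first: "strict_antimono_on (larger_before ?\<pi> 1) ?\<pi>" by simp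
  have "0 < \<sigma> i" if "i \<in> {1..r}" for i
    using that permutes_in_image[OF \<sigma>, of i] by simp
  then have "{i \<in> {1..r}. skip p i < p + 2 \<and> 1 < skip p (\<sigma> i)} = {1..p}"
    using p by (auto simp: skip_def)
  then have low: "strict_antimono_on (larger_before ?\<pi> (p + 2)) ?\<pi> \<longleftrightarrow> strict_antimono_on {1..p} \<sigma>"
    using p by (simp add: strict_antimono_on_larger_before_insert3 insert3_cycle)
  have "{i \<in> {1..r}. skip p i < r + 3 \<and> p + 2 < skip p (\<sigma> i)} = {i \<in> {1..r}. p < \<sigma> i}"
    by (auto simp: skip_def)
  then have high: "strict_antimono_on (larger_before ?\<pi> (r + 3)) ?\<pi> \<longleftrightarrow>
      strict_antimono_on {i \<in> {1..r}. p < \<sigma> i} \<sigma>"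
    by (simp add: strict_antimono_on_larger_before_insert3 insert3_cycle)
  have inner: "strict_antimono_on (larger_before ?\<pi> (skip p k)) ?\<pi> \<longleftrightarrow>
      strict_antimono_on (larger_before \<sigma> k) \<sigma>" if "k \<in> {1..r}" for k
  proof -
    have "{i \<in> {1..r}. skip p i < skip p k \<and> skip p (\<sigma> k) < skip p (\<sigma> i)} = larger_before \<sigma> k"
      using that by (auto simp: strict_mono_less[OF strict_mono_skip] larger_before_def)
    moreover have "skip p k \<in> {2..r + 3}" using that p by (auto simp: skip_def)
    ultimately show ?thesis
      using that by (simp add: strict_antimono_on_larger_before_insert3 insert3_skip)
  qed
  show ?thesis
    unfolding avoids231_iff[OF permutes_inj[OF \<sigma>]]
      avoids231_iff[OF permutes_inj[OF insert3_permutes]] skip_split ball_Un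
    using p by (auto simp: first low high inner cut_heights_def)
qed

lemma insert3_in_avoiders:
  "(r + 3, insert3 r p \<sigma>) \<in> avoiders \<longleftrightarrow> ((r, \<sigma>), p) \<in> cuts avoiders"
  using insert3_permutes \<sigma>
  by (auto simp: cuts_iff avoiders_iff S3_231_iff avoids231_insert3 cycle_type_insert3)

end

lemma insert3E:
  assumes \<pi>: "\<pi> permutes {1..r + 3}" and cycle: "\<pi> 1 = r + 3" "\<pi> (r + 3) = p + 2" "\<pi> (p + 2) = 1"
  obtains \<sigma> where "\<sigma> permutes {1..r}" "\<pi> = insert3 r p \<sigma>"
proof -
  have "\<pi> x = cycle_of_list [1, r + 3, p + 2] x" if "x \<in> set [1, r + 3, p + 2]" for x
    using that cycle p by (auto simp: transpose_def)
  then obtain \<alpha> where \<alpha>: "\<alpha> permutes skip p ` {1..r}" "\<pi> = \<alpha> \<circ> cycle_of_list [1, r + 3, p + 2]"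
    using permutes_Un_eq_onE[OF \<pi>[unfolded skip_split] skip_disjoint cycle_permutes] by blast
  moreover obtain \<sigma> where "\<sigma> permutes {1..r}" "\<alpha> = map_permutation {1..r} (skip p) \<sigma>"
    using permutes_imageE[OF \<alpha>(1) inj_on_skip] .
  ultimately show thesis using that by (simp add: insert3_def)
qed

end

lemma cuts_avoidersD:
  "((r, \<sigma>), p) \<in> cuts avoiders \<Longrightarrow> \<sigma> permutes {1..r}"
  "((r, \<sigma>), p) \<in> cuts avoiders \<Longrightarrow> p \<le> r"
  by (auto simp: cuts_iff dest: avoiders_permutes cut_heights_le)

lemma insert3_inject:
  assumes "((r, \<sigma>), p) \<in> cuts avoiders" "((r, \<sigma>'), p') \<in> cuts avoiders"
    and eq: "insert3 r p \<sigma> = insert3 r p' \<sigma>'"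
  shows "\<sigma> = \<sigma>' \<and> p = p'"
proof -
  have \<sigma>: "\<sigma> permutes {1..r}" "p \<le> r" and \<sigma>': "\<sigma>' permutes {1..r}" "p' \<le> r"
    using assms(1,2) by (simp_all add: cuts_avoidersD)
  have p: "p = p'"
    using insert3_cycle(2)[OF \<sigma>(2,1)] insert3_cycle(2)[OF \<sigma>'(2,1)] eq by simp
  have "\<sigma> i = \<sigma>' i" if "i \<in> {1..r}" for i
    using insert3_skip[OF \<sigma>(2,1) that] insert3_skip[OF \<sigma>'(2,1) that] eq
    by (simp add: p strict_mono_eq[OF strict_mono_skip])
  then show ?thesis using p \<sigma>(1) \<sigma>'(1) by (metis ext permutes_not_in)
qed

lemma outer_3cycleE:
  assumes "(n, \<pi>) \<in> outer_3cycle"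
  obtains r \<sigma> p where "n = r + 3" "\<pi> = insert3 r p \<sigma>" "((r, \<sigma>), p) \<in> cuts avoiders"
proof -
  have \<pi>: "(n, \<pi>) \<in> avoiders" "1 < \<pi> n" "\<pi> n < n" "\<pi> 1 = n" "\<pi> (\<pi> n) = 1"
    using assms by (simp_all add: outer_3cycle_iff)
  define r p where "r = n - 3" and "p = \<pi> n - 2"
  have n: "n = r + 3" "\<pi> n = p + 2" and p: "p \<le> r" using \<pi>(2,3) by (auto simp: r_def p_def)
  obtain \<sigma> where \<sigma>: "\<sigma> permutes {1..r}" "\<pi> = insert3 r p \<sigma>"
    using insert3E[OF p, of \<pi>] avoiders_permutes[OF \<pi>(1)] \<pi>(4,5) n by metis
  then have "((r, \<sigma>), p) \<in> cuts avoiders" using insert3_in_avoiders[OF p \<sigma>(1)] \<pi>(1) n by simp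
  with n(1) \<sigma>(2) show thesis by (rule that)
qed

lemma insert3_in_outer_3cycle:
  assumes "((r, \<sigma>), p) \<in> cuts avoiders"
  shows "(r + 3, insert3 r p \<sigma>) \<in> outer_3cycle"
proof -
  note \<sigma>_p = cuts_avoidersD(2,1)[OF assms]
  show ?thesis
    using assms \<sigma>_p insert3_cycle[OF \<sigma>_p] insert3_in_avoiders[OF \<sigma>_p]
    by (simp add: outer_3cycle_iff)
qed

lemma bij_betw_insert3:
  "bij_betw (\<lambda>((r, \<sigma>), p). (r + 3, insert3 r p \<sigma>)) (cuts avoiders) outer_3cycle"
  (is "bij_betw ?f _ _")
proof (rule bij_betw_imageI)
  show "inj_on ?f (cuts avoiders)"
    using insert3_inject by (auto simp: inj_on_def)
  have "v \<in> ?f ` cuts avoiders" if "v \<in> outer_3cycle" for v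
  proof -
    obtain n \<pi> where v: "v = (n, \<pi>)" by (cases v)
    with that obtain r \<sigma> p where "n = r + 3" "\<pi> = insert3 r p \<sigma>" "((r, \<sigma>), p) \<in> cuts avoiders"
      using outer_3cycleE by blast
    then show ?thesis unfolding v by (auto intro!: image_eqI[of _ _ "((r, \<sigma>), p)"])
  qed
  moreover have "?f u \<in> outer_3cycle" if "u \<in> cuts avoiders" for u
    using that by (cases u) (auto simp: insert3_in_outer_3cycle)
  ultimately show "?f ` cuts avoiders = outer_3cycle" by (intro equalityI image_subsetI subsetI)
qed

lemma genfun_outer_3cycle:
  "genfun perm_wt outer_3cycle = genfun (\<lambda>u. perm_wt (fst u)) (cuts avoiders) * varY"
proof -
  have "genfun perm_wt outer_3cycle = genfun (\<lambda>u. perm_wt (fst u) + (0, 0, 1)) (cuts avoiders)"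
    by (rule genfun_bij_betw[OF bij_betw_insert3]) (auto simp: perm_wt_insert3 cuts_avoidersD)
  then show ?thesis
    by (simp add: genfun_shift[OF finite_fibres_cuts[OF finite_fibres_avoiders]] monomial_def)
qed

section \<open>Cut heights\<close>

lemma cut_heights_reversal: "cut_heights r (reversal r) = {0..r}"
  by (auto simp: cut_heights_def intro!: monotone_on_subset[OF strict_antimono_on_reversal])

lemma outer_3cycle_in_cut_heights:
  assumes "(r, \<sigma>) \<in> outer_3cycle" and p: "p \<le> \<sigma> r" "\<sigma> r \<le> p + 1"
  shows "p \<in> cut_heights r \<sigma>"
proof -
  have av: "(r, \<sigma>) \<in> avoiders" and k: "1 < \<sigma> r" "\<sigma> r < r" "\<sigma> (\<sigma> r) = 1"
    using assms(1) by (simp_all add: outer_3cycle_iff)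
  have "strict_antimono_on {1..\<sigma> r} \<sigma>"
    using avoider_decreasing_upto_1[OF av, of "\<sigma> r"] k by simp
  then have "strict_antimono_on {1..p} \<sigma>" by (rule monotone_on_subset) (use p in auto)
  moreover have "strict_antimono_on {i \<in> {1..r}. \<sigma> r \<le> \<sigma> i} \<sigma>"
    using avoider_decreasing_on_ge[OF av, of r] k by simp
  then have "strict_antimono_on {i \<in> {1..r}. p < \<sigma> i} \<sigma>"
    by (rule monotone_on_subset) (use p in auto)
  ultimately show ?thesis using p k by (simp add: cut_heights_def)
qed

lemma outer_3cycle_cut_heightsD:
  assumes "(r, \<sigma>) \<in> outer_3cycle" "p \<in> cut_heights r \<sigma>"
  shows "p \<le> \<sigma> r" "\<sigma> r \<le> p + 1"
proof -
  have k: "1 < \<sigma> r" "\<sigma> r < r" "\<sigma> (\<sigma> r) = 1" and \<sigma>: "\<sigma> permutes {1..r}"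
    using assms(1) by (simp_all add: outer_3cycle_iff avoiders_permutes)
  have low: "strict_antimono_on {1..p} \<sigma>" and high: "strict_antimono_on {i \<in> {1..r}. p < \<sigma> i} \<sigma>"
    using assms(2) by (simp_all add: cut_heights_def)
  show "p \<le> \<sigma> r"
  proof (rule ccontr)
    assume "\<not> p \<le> \<sigma> r"
    then have "\<sigma> (\<sigma> r + 1) < \<sigma> (\<sigma> r)" by (intro monotone_onD[OF low]) (use k in auto)
    moreover have "\<sigma> (\<sigma> r + 1) \<in> {1..r}" using permutes_in_image[OF \<sigma>, of "\<sigma> r + 1"] k by simp
    ultimately show False using k by simp
  qed
  show "\<sigma> r \<le> p + 1"
  proof (rule ccontr)
    assume p: "\<not> \<sigma> r \<le> p + 1"
    have "\<sigma> r - 1 \<in> \<sigma> ` {1..r}" using permutes_image[OF \<sigma>] k by auto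
    then obtain u where u: "u \<in> {1..r}" "\<sigma> u = \<sigma> r - 1" by auto
    then have "u \<noteq> r" using k by auto
    then have "\<sigma> r < \<sigma> u" by (intro monotone_onD[OF high]) (use u p k in auto)
    then show False using u(2) by simp
  qed
qed

lemma cut_heights_outer_3cycle:
  assumes "(r, \<sigma>) \<in> outer_3cycle"
  shows "cut_heights r \<sigma> = {\<sigma> r - 1, \<sigma> r}"
proof -
  have "p \<in> cut_heights r \<sigma> \<longleftrightarrow> p = \<sigma> r - 1 \<or> p = \<sigma> r" for p
    using assms outer_3cycle_in_cut_heights[OF assms, of p]
      outer_3cycle_cut_heightsD[OF assms, of p]
    by (auto simp: outer_3cycle_iff)
  then show ?thesis by blast
qed

lemma card_cut_heights_outer_3cycle: "(n, \<pi>) \<in> outer_3cycle \<Longrightarrow> card (cut_heights n \<pi>) = 2"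
  by (auto simp: cut_heights_outer_3cycle outer_3cycle_iff card_insert_if)

lemma cut_heights_dsum_unique:
  assumes \<sigma>: "\<sigma> permutes {1..r}" and \<tau>: "\<tau> permutes {1..s}" and "1 \<le> r" "1 \<le> s"
    and p: "p \<in> cut_heights (r + s) (dsum r s \<sigma> \<tau>)"
  shows "p = r"
proof -
  let ?\<pi> = "dsum r s \<sigma> \<tau>"
  have high: "r < ?\<pi> (r + 1)" using dsum_right_greater[OF \<sigma> \<tau>, of 1] assms(4) by simp
  show ?thesis
  proof (rule linorder_cases[of p r])
    assume "p < r"
    have anti: "strict_antimono_on {i \<in> {1..r + s}. p < ?\<pi> i} ?\<pi>"
      using p by (simp add: cut_heights_def)
    have "r \<in> \<sigma> ` {1..r}" using permutes_image[OF \<sigma>] assms(3) by simp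
    then obtain u where u: "u \<in> {1..r}" "?\<pi> u = r" using dsum_left[OF \<sigma> \<tau>] by auto
    have "?\<pi> (r + 1) < ?\<pi> u"
      by (rule monotone_onD[OF anti]) (use u \<open>p < r\<close> high assms(4) in auto)
    then show ?thesis using high u(2) by simp
  next
    assume "r < p"
    have anti: "strict_antimono_on {1..p} ?\<pi>" using p by (simp add: cut_heights_def)
    have "?\<pi> (r + 1) < ?\<pi> r"
      by (rule monotone_onD[OF anti]) (use \<open>r < p\<close> assms(3) in auto)
    then show ?thesis using high dsum_left_le[OF \<sigma> \<tau>, of r] assms(3) by simp
  qed
qed

lemma cut_heights_dsum:
  assumes \<sigma>: "\<sigma> permutes {1..r}" and \<tau>: "\<tau> permutes {1..s}" and "1 \<le> r" "1 \<le> s"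
  shows "cut_heights (r + s) (dsum r s \<sigma> \<tau>) =
    (if \<sigma> = reversal r \<and> \<tau> = reversal s then {r} else {})"
proof -
  let ?\<pi> = "dsum r s \<sigma> \<tau>"
  have "strict_antimono_on {1..r} ?\<pi> \<longleftrightarrow> strict_antimono_on {1..r} \<sigma>"
    by (rule monotone_on_cong) (rule dsum_left[OF \<sigma> \<tau>])
  moreover have "{i \<in> {1..r + s}. r < ?\<pi> i} = (+) r ` {1..s}"
    using dsum_left_le[OF \<sigma> \<tau>] dsum_right_greater[OF \<sigma> \<tau>] unfolding atLeastAtMost_add_split
    by (fastforce simp del: image_add_atLeastAtMost)
  moreover have "strict_antimono_on ((+) r ` {1..s}) ?\<pi> \<longleftrightarrow> strict_antimono_on {1..s} \<tau>"
    by (rule strict_antimono_on_relabel)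
      (use dsum_right[OF \<sigma> \<tau>] in \<open>auto simp: strict_mono_def\<close>)
  ultimately have "r \<in> cut_heights (r + s) ?\<pi> \<longleftrightarrow> \<sigma> = reversal r \<and> \<tau> = reversal s"
    using strict_antimono_on_iff_reversal[OF \<sigma>] strict_antimono_on_iff_reversal[OF \<tau>]
    by (simp add: cut_heights_def)
  then show ?thesis using cut_heights_dsum_unique[OF assms] by auto
qed

definition reversals :: "(nat \<times> (nat \<Rightarrow> nat)) set" where
  "reversals = range (\<lambda>n. (n, reversal n))"

definition reversal_sums :: "(nat \<times> (nat \<Rightarrow> nat)) set" where
  "reversal_sums = (\<lambda>(p, q). (p + q, dsum p q (reversal p) (reversal q))) ` ({1..} \<times> {1..})"

lemma reversal_sums_in_avoiders: "reversal_sums \<subseteq> avoiders"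
  using dsum_in_avoiders[OF reversal_permutes reversal_permutes] reversal_in_avoiders
  by (auto simp: reversal_sums_def)

lemma reversal_sums_first_less:
  assumes "(n, \<pi>) \<in> reversal_sums"
  shows "\<pi> 1 < n"
proof -
  obtain p q where "n = p + q" "\<pi> = dsum p q (reversal p) (reversal q)" "1 \<le> p" "1 \<le> q"
    using assms by (auto simp: reversal_sums_def)
  then show ?thesis
    using dsum_left[OF reversal_permutes reversal_permutes, of 1 p q] by (simp add: reversal_def)
qed

lemma reversal_not_in_reversal_sums: "(n, reversal n) \<notin> reversal_sums"
  by (auto dest!: reversal_sums_first_less simp: reversal_def split: if_splits)

lemma card_cut_heights_reversal_sums: "(n, \<pi>) \<in> reversal_sums \<Longrightarrow> card (cut_heights n \<pi>) = 1"
  by (auto simp: reversal_sums_def cut_heights_dsum[OF reversal_permutes reversal_permutes])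

lemma cut_heights_cases:
  assumes "(n, \<pi>) \<in> avoiders" "p \<in> cut_heights n \<pi>"
  shows "\<pi> = reversal n \<or> (n, \<pi>) \<in> outer_3cycle \<or> (n, \<pi>) \<in> reversal_sums"
proof (cases "n = 0")
  case True
  then show ?thesis using avoiders_permutes[OF assms(1)] by (auto simp: reversal_def)
next
  case False
  then have "1 \<le> n" by simp
  with assms(1) obtain r \<sigma> s \<tau> where n: "n = r + s" "\<pi> = dsum r s \<sigma> \<tau>"
    and "(r, \<sigma>) \<in> avoiders" "(s, \<tau>) \<in> max_first"
    by (rule avoiders_dsumE)
  then have perm: "\<sigma> permutes {1..r}" "\<tau> permutes {1..s}" and s: "1 \<le> s" "\<tau> 1 = s"
    by (auto simp: max_first_iff avoiders_permutes)
  show ?thesis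
  proof (cases "r = 0")
    case True
    then have "(n, \<pi>) \<in> max_first"
      using assms(1) dsum_right[OF perm, of 1] n s by (simp add: max_first_iff)
    then show ?thesis using max_first_cases by blast
  next
    case False
    then have "\<sigma> = reversal r \<and> \<tau> = reversal s"
      using assms(2) cut_heights_dsum[OF perm] s(1) n by (auto split: if_splits)
    then show ?thesis using n False s(1) by (auto simp: reversal_sums_def image_iff)
  qed
qed

lemma cuts_avoiders_split:
  "cuts avoiders = cuts reversals \<union> (cuts outer_3cycle \<union> cuts reversal_sums)"
  (is "_ = ?C")
proof (rule set_eqI)
  fix u :: "(nat \<times> (nat \<Rightarrow> nat)) \<times> nat"
  obtain n \<pi> p where u: "u = ((n, \<pi>), p)" by (metis surj_pair)
  show "u \<in> cuts avoiders \<longleftrightarrow> u \<in> ?C"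
    using cut_heights_cases[of n \<pi> p] reversal_in_avoiders[of n] reversal_sums_in_avoiders
    unfolding u by (auto simp: cuts_iff outer_3cycle_iff reversals_def)
qed

lemma genfun_cuts_reversals:
  "genfun (\<lambda>u. perm_wt (fst u)) (cuts reversals) = genfun (\<lambda>u. reversal_wt (fst u)) triangle"
proof (rule genfun_bij_betw)
  show "bij_betw (\<lambda>(n, p). ((n, reversal n), p)) triangle (cuts reversals)"
    by (rule bij_betw_imageI)
      (auto simp: inj_on_def image_iff triangle_def cuts_def reversals_def cut_heights_reversal)
qed (auto simp: perm_wt_reversal)

lemma genfun_cuts_outer_3cycle:
  "genfun (\<lambda>u. perm_wt (fst u)) (cuts outer_3cycle) = 2 * genfun perm_wt outer_3cycle"
proof -
  have "outer_3cycle \<subseteq> avoiders" by (auto simp: outer_3cycle_iff)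
  then have "finite_fibres perm_wt outer_3cycle"
    by (rule finite_fibres_subset[OF finite_fibres_avoiders])
  then have "genfun (\<lambda>u. perm_wt (fst u)) (cuts outer_3cycle) =
      of_nat 2 * genfun perm_wt outer_3cycle"
    unfolding cuts_def
    by (rule genfun_Sigma_card) (auto simp: finite_cut_heights card_cut_heights_outer_3cycle)
  then show ?thesis by simp
qed

lemma genfun_reversal_sums: "genfun perm_wt reversal_sums = (genfun reversal_wt UNIV - 1)\<^sup>2"
proof -
  let ?f = "\<lambda>(p, q). (p + q, dsum p q (reversal p) (reversal q))"
  have "p = p'" if "1 \<le> p" "1 \<le> p'"
    "dsum p q (reversal p) (reversal q) = dsum p' q' (reversal p') (reversal q')" for p q p' q'
    using that dsum_left[OF reversal_permutes reversal_permutes, of 1 p q]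
      dsum_left[OF reversal_permutes reversal_permutes, of 1 p' q']
    by (simp add: reversal_def)
  then have "inj_on ?f ({1..} \<times> {1..})" by (fastforce simp: inj_on_def)
  then have "genfun perm_wt reversal_sums =
      genfun (\<lambda>u. reversal_wt (fst u) + reversal_wt (snd u)) ({1..} \<times> {1..})"
    unfolding reversal_sums_def
    by (subst genfun_image)
      (simp_all add: case_prod_beta perm_wt_reversal
        perm_wt_dsum[OF reversal_permutes reversal_permutes])
  also have "\<dots> = genfun reversal_wt {1..} * genfun reversal_wt {1..}"
    by (rule genfun_Times[OF finite_fibres_reversal_wt finite_fibres_reversal_wt])
  finally show ?thesis by (simp add: genfun_reversal_wt_ge_1 power2_eq_square)
qed

lemma genfun_cuts_reversal_sums:
  "genfun (\<lambda>u. perm_wt (fst u)) (cuts reversal_sums) = (genfun reversal_wt UNIV - 1)\<^sup>2"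
proof -
  have "finite_fibres perm_wt reversal_sums"
    using finite_fibres_avoiders reversal_sums_in_avoiders by (rule finite_fibres_subset)
  then have "genfun (\<lambda>u. perm_wt (fst u)) (cuts reversal_sums) =
      of_nat 1 * genfun perm_wt reversal_sums"
    unfolding cuts_def
    by (rule genfun_Sigma_card) (auto simp: finite_cut_heights card_cut_heights_reversal_sums)
  then show ?thesis by (simp add: genfun_reversal_sums)
qed

lemma genfun_cuts_avoiders:
  "genfun (\<lambda>u. perm_wt (fst u)) (cuts avoiders) =
    genfun (\<lambda>u. reversal_wt (fst u)) triangle + 2 * genfun perm_wt outer_3cycle +
    (genfun reversal_wt UNIV - 1)\<^sup>2"
proof -
  have "outer_3cycle \<inter> reversal_sums = {}"
    using reversal_sums_first_less by (fastforce simp: outer_3cycle_iff)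
  then have "cuts outer_3cycle \<inter> cuts reversal_sums = {}"
    unfolding cuts_def by blast
  moreover have "reversals \<inter> (outer_3cycle \<union> reversal_sums) = {}"
    using reversal_not_in_outer_3cycle reversal_not_in_reversal_sums by (auto simp: reversals_def)
  then have "cuts reversals \<inter> (cuts outer_3cycle \<union> cuts reversal_sums) = {}"
    unfolding cuts_def by blast
  ultimately show ?thesis
    using genfun_Un3[OF finite_fibres_cuts[OF finite_fibres_avoiders, unfolded cuts_avoiders_split]]
    by (simp add: cuts_avoiders_split genfun_cuts_reversals genfun_cuts_outer_3cycle
        genfun_cuts_reversal_sums add.assoc)
qed

section \<open>Functional equations\<close>

lemma functional_equations_imp_rational:
  fixes B D E M t x y :: "'a :: comm_ring_1"
  assumes B_eq: "B = 1 + B * (E - 1 + D)" and D_eq: "D = (M + 2 * D + (E - 1)\<^sup>2) * y"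
    and E_eq: "E * (1 - x) = 1 + t" and M_eq: "M * (1 - x) = 2 * E - 1"
  shows "B * (1 - 3*x - 3*y - t + 2*x^2 + 5*x*y + t*x - 5*x^2*y - 4*t*x*y - t^2*y) =
    (1 - x)^2 * (1 - 2*y)"
proof -
  have E_minus_1: "(E - 1) * (1 - x) = t + x" by (simp add: left_diff_distrib E_eq)
  have "(2 - E) * (1 - x)\<^sup>2 = (2 * (1 - x) - E * (1 - x)) * (1 - x)"
    by (simp add: algebra_simps power2_eq_square)
  also have "2 * (1 - x) - E * (1 - x) = 1 - 2 * x - t"
    unfolding E_eq by (simp add: algebra_simps)
  finally have two_minus_E: "(2 - E) * (1 - x)\<^sup>2 = (1 - 2 * x - t) * (1 - x)" .
  have "M * (1 - x)\<^sup>2 = (2 * E - 1) * (1 - x)"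
    by (simp only: power2_eq_square M_eq flip: mult.assoc)
  also have "\<dots> = 2 * (E * (1 - x)) - (1 - x)" by (simp add: algebra_simps)
  finally have M_times: "M * (1 - x)\<^sup>2 = 1 + x + 2 * t" unfolding E_eq by simp
  have "D * (1 - 2 * y) = (M + (E - 1)\<^sup>2) * y"
    using arg_cong[OF D_eq, of "\<lambda>z. z - 2 * D * y"] by (simp add: algebra_simps)
  then have "D * (1 - 2 * y) * (1 - x)\<^sup>2 = (M * (1 - x)\<^sup>2 + ((E - 1) * (1 - x))\<^sup>2) * y"
    by (simp add: power_mult_distrib) (simp add: algebra_simps)
  then have D_times: "D * (1 - 2 * y) * (1 - x)\<^sup>2 = (1 + x + 2 * t + (t + x)\<^sup>2) * y"
    unfolding E_minus_1 M_times .
  have "B * (1 - (E - 1 + D)) = 1" using B_eq unfolding affine_fixed_point_iff .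
  then have "B * (2 - E - D) = 1" by (simp add: algebra_simps)
  then have "(1 - x)\<^sup>2 * (1 - 2 * y) = B * (2 - E - D) * ((1 - x)\<^sup>2 * (1 - 2 * y))" by simp
  also have "\<dots> = B * ((2 - E) * (1 - x)\<^sup>2 * (1 - 2 * y) - D * (1 - 2 * y) * (1 - x)\<^sup>2)"
    by (simp add: left_diff_distrib right_diff_distrib mult_ac)
  also have "\<dots> =
      B * ((1 - 2 * x - t) * (1 - x) * (1 - 2 * y) - (1 + x + 2 * t + (t + x)\<^sup>2) * y)"
    unfolding two_minus_E D_times ..
  finally show ?thesis by (simp add: algebra_simps power2_eq_square)
qed

theorem theorem3p1:
  shows "Bseries * (1 - 3*varX - 3*varY - varT + 2*varX^2 + 5*varX*varY + varT*varX
                    - 5*varX^2*varY - 4*varT*varX*varY - varT^2*varY)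
         = (1 - varX)^2 * (1 - 2*varY)"
proof -
  define D where "D = genfun perm_wt outer_3cycle"
  define E where "E = genfun reversal_wt UNIV"
  define M where "M = genfun (\<lambda>u. reversal_wt (fst u)) triangle"
  have B_eq: "Bseries = 1 + Bseries * (E - 1 + D)"
    using genfun_avoiders unfolding genfun_max_first D_def E_def Bseries_eq_genfun .
  have D_eq: "D = (M + 2 * D + (E - 1)\<^sup>2) * varY"
    using genfun_outer_3cycle unfolding genfun_cuts_avoiders D_def E_def M_def .
  have E_eq: "E * (1 - varX) = 1 + varT"
    unfolding E_def by (rule genfun_reversal_wt)
  have M_eq: "M * (1 - varX) = 2 * E - 1"
    unfolding M_def E_def by (rule genfun_triangle)
  show ?thesis
    by (rule functional_equations_imp_rational[OF B_eq D_eq E_eq M_eq])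
qed

end
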